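(* Let $d\in\mathbb{N}^+$ and let $0<\alpha<1$ with $1>\alpha d$. Let $\{X(t):t\in\mathbb{R}\}$ be a $d$-dimensional fractional Brownian motion of Hurst index $\alpha$. Let $A\subset\mathbb{R}$ be an analytic set with $\dim_P A=\beta$. Then, almost surely, $$\dim_P X^*(A)\ge \max\left\{\frac{\beta d}{\alpha d+\beta(1-\alpha d)},\ \beta(d+1-\alpha d)\right\}.$$
   Context: $\dim_P$ denotes packing dimension. $X^*(t)=(t,X(t))$, so $X^*(A)$ is the graph of $X|_A$. A $d$-dimensional fractional Brownian motion of Hurst index $\alpha$ on $\mathbb{R}$ is $X=(X_1,\dots,X_d)$ with $X_i$ i.i.d. copies of a centered real Gaussian process $X_0$ with $X_0(0)=0$, almost surely continuous paths and $\mathrm{Cov}(X_0(t),X_0(s))=\frac12(|t|^{2\alpha}+|s|^{2\alpha}-|t-s|^{2\alpha})$. *)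

theory Defs
  imports "HOL-Probability.Probability"
begin

definition packing_premeasure_delta :: "real \<Rightarrow> real \<Rightarrow> 'a::metric_space set \<Rightarrow> ennreal" where
  "packing_premeasure_delta s \<delta> E =
     (SUP p \<in> {(I, c, r) | (I :: nat set) (c :: nat \<Rightarrow> 'a) (r :: nat \<Rightarrow> real).
                  (\<forall>i\<in>I. c i \<in> E \<and> 0 < r i \<and> r i \<le> \<delta>) \<and>
                  disjoint_family_on (\<lambda>i. cball (c i) (r i)) I}.
        (case p of (I, c, r) \<Rightarrow>
           (\<Sum>i. if i \<in> I then ennreal ((2 * r i) powr s) else 0)))"

definition packing_premeasure :: "real \<Rightarrow> 'a::metric_space set \<Rightarrow> ennreal" where
  "packing_premeasure s E = (INF \<delta> \<in> {0<..}. packing_premeasure_delta s \<delta> E)"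

definition packing_measure :: "real \<Rightarrow> 'a::metric_space set \<Rightarrow> ennreal" where
  "packing_measure s E =
     (INF S \<in> {S :: nat \<Rightarrow> 'a set. E \<subseteq> (\<Union>i. S i)}. \<Sum>i. packing_premeasure s (S i))"

definition packing_dim :: "'a::metric_space set \<Rightarrow> ereal" where
  "packing_dim E = Inf (ereal ` {s. 0 \<le> s \<and> packing_measure s E = 0})"

text \<open>Continuous images of the Baire space (nat \<Rightarrow> nat with the product topology of
  discrete copies of nat), together with the empty set.\<close>
definition analytic_set :: "real set \<Rightarrow> bool" where
  "analytic_set A \<longleftrightarrow> A = {} \<or> (\<exists>f :: (nat \<Rightarrow> nat) \<Rightarrow> real. continuous_on UNIV f \<and> f ` UNIV = A)"

definition fbm_cov :: "real \<Rightarrow> real \<Rightarrow> real \<Rightarrow> real" where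
  "fbm_cov \<alpha> t s = (\<bar>t\<bar> powr (2*\<alpha>) + \<bar>s\<bar> powr (2*\<alpha>) - \<bar>t - s\<bar> powr (2*\<alpha>)) / 2"

definition real_gaussian :: "'w measure \<Rightarrow> ('w \<Rightarrow> real) \<Rightarrow> real \<Rightarrow> real \<Rightarrow> bool" where
  "real_gaussian M Y m v \<longleftrightarrow> Y \<in> borel_measurable M \<and>
     ((v = 0 \<and> (AE \<omega> in M. Y \<omega> = m)) \<or>
      (0 < v \<and> distributed M lborel Y (normal_density m (sqrt v))))"

definition centered_gaussian_process ::
    "'w measure \<Rightarrow> ('w \<Rightarrow> real \<Rightarrow> real) \<Rightarrow> (real \<Rightarrow> real \<Rightarrow> real) \<Rightarrow> bool" where
  "centered_gaussian_process M Y K \<longleftrightarrow>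
     (\<forall>(n::nat) (t::nat \<Rightarrow> real) (c::nat \<Rightarrow> real).
        real_gaussian M (\<lambda>\<omega>. \<Sum>k<n. c k * Y \<omega> (t k)) 0
          (\<Sum>k<n. \<Sum>l<n. c k * c l * K (t k) (t l)))"

definition fbm :: "'w measure \<Rightarrow> real \<Rightarrow> ('w \<Rightarrow> real \<Rightarrow> real ^ 'd) \<Rightarrow> bool" where
  "fbm M \<alpha> X \<longleftrightarrow> prob_space M \<and>
     (\<forall>i. centered_gaussian_process M (\<lambda>\<omega> t. X \<omega> t $ i) (fbm_cov \<alpha>)) \<and>
     prob_space.indep_vars M (\<lambda>_. Pi\<^sub>M UNIV (\<lambda>_. borel)) (\<lambda>i \<omega>. (\<lambda>t. X \<omega> t $ i)) UNIV \<and>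
     (\<forall>\<omega>\<in>space M. X \<omega> 0 = 0) \<and>
     (AE \<omega> in M. continuous_on UNIV (X \<omega>))"

definition graph_map :: "(real \<Rightarrow> 'b) \<Rightarrow> real \<Rightarrow> real \<times> 'b" where
  "graph_map f t = (t, f t)"

end

theory Submission
  imports Defs
begin

text \<open>Packing dimension is compared with separation counts: \<open>box_bounded s E\<close> says that \<open>e\<close>-separated
  subsets of \<open>E\<close> have \<open>O(e powr (- s))\<close> points as \<open>e\<close> tends to \<open>0\<close>. A Baire category argument in the
  parametrising Baire space reduces the theorem to countably many sets \<open>B\<close> that are not
  \<open>box_bounded \<gamma>\<close>, for \<open>\<gamma> < \<beta>\<close>: it suffices that almost surely the graph over each \<open>B\<close> is not
  \<open>box_bounded \<sigma>\<close>.

  Such a \<open>B\<close> contains, for arbitrarily small \<open>r\<close>, an \<open>r\<close>-separated set of about \<open>r powr (- \<gamma>)\<close> times. At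
  the scale \<open>r powr \<kappa>\<close>, a point of the graph over these times has in expectation boundedly many
  neighbours, because \<open>P(|X t - X s| \<le> u) \<le> u^d |t - s|^(- \<alpha> d)\<close>; hence a positive proportion of them,
  up to \<open>r powr (- \<eta>)\<close>, is separated at that scale, which gives the exponent \<open>\<gamma> / \<kappa>\<close>. Two choices of \<open>\<kappa>\<close> are
  admissible: \<open>\<alpha> + \<gamma> (1 - \<alpha> d) / d\<close>, using all pairs of times, and \<open>1 / (d + 1 - \<alpha> d)\<close>, using
  that points of the graph can only be close if their times are. They yield the two terms of the maximum.\<close>

section \<open>Separation counts and packing measures\<close>

text \<open>The strict inequality makes closed balls of radius \<open>e / 2\<close> about the points
  disjoint, and lets a finite separated set be perturbed slightly.\<close>

definition separated :: "real \<Rightarrow> 'a::metric_space set \<Rightarrow> bool" where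
  "separated e P \<longleftrightarrow> (\<forall>x\<in>P. \<forall>y\<in>P. x \<noteq> y \<longrightarrow> e < dist x y)"

text \<open>For nonempty \<open>E\<close> this holds for every \<open>s\<close> above the upper
  box-counting (Minkowski) dimension of \<open>E\<close> and fails for every \<open>s\<close> below
  it.\<close>

definition box_bounded :: "real \<Rightarrow> 'a::metric_space set \<Rightarrow> bool" where
  "box_bounded s E \<longleftrightarrow> (\<exists>C \<delta>. 0 < \<delta> \<and>
     (\<forall>e P. 0 < e \<and> e \<le> \<delta> \<and> finite P \<and> P \<subseteq> E \<and> separated e P \<longrightarrow>
        real (card P) \<le> C * e powr (- s)))"

lemma separatedD: "separated e P \<Longrightarrow> x \<in> P \<Longrightarrow> y \<in> P \<Longrightarrow> x \<noteq> y \<Longrightarrow> e < dist x y"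
  by (auto simp: separated_def)

lemma separated_mono: "separated e P \<Longrightarrow> Q \<subseteq> P \<Longrightarrow> separated e Q"
  by (auto simp: separated_def)

lemma packing_premeasure_delta_upper:
  fixes I :: "nat set"
  assumes "\<And>i. i \<in> I \<Longrightarrow> c i \<in> E \<and> 0 < r i \<and> r i \<le> \<delta>"
    and "disjoint_family_on (\<lambda>i. cball (c i) (r i)) I"
  shows "(\<Sum>i. if i \<in> I then ennreal ((2 * r i) powr s) else 0) \<le> packing_premeasure_delta s \<delta> E"
  unfolding packing_premeasure_delta_def
  by (rule SUP_upper2[where i = "(I, c, r)"]) (use assms in auto)

lemma packing_premeasure_delta_least:
  assumes "\<And>(I::nat set) c r. (\<And>i. i \<in> I \<Longrightarrow> c i \<in> E \<and> 0 < r i \<and> r i \<le> \<delta>) \<Longrightarrow>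
      disjoint_family_on (\<lambda>i. cball (c i) (r i)) I \<Longrightarrow>
      (\<Sum>i. if i \<in> I then ennreal ((2 * r i) powr s) else 0) \<le> B"
  shows "packing_premeasure_delta s \<delta> E \<le> B"
  unfolding packing_premeasure_delta_def
  by (rule SUP_least) (use assms in auto)

text \<open>Closed balls of radius \<open>e / 2\<close> about an \<open>e\<close>-separated set
  \<open>P\<close> form a packing of weight \<open>card P * e powr s\<close>, which the finite value
  at scale \<open>\<delta>\<close> bounds.\<close>

lemma box_bounded_if_premeasure_finite:
  assumes "packing_premeasure s E < \<infinity>"
  shows "box_bounded s E"
proof -
  obtain \<delta> where \<delta>: "0 < \<delta>" "packing_premeasure_delta s \<delta> E < \<infinity>"
    using assms unfolding packing_premeasure_def by (auto simp: INF_less_iff)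
  define C where "C = enn2real (packing_premeasure_delta s \<delta> E)"
  have "real (card P) \<le> C * e powr (- s)"
    if e: "0 < e" "e \<le> \<delta>" and P: "finite P" "P \<subseteq> E" "separated e P" for e P
  proof -
    obtain c where c: "bij_betw c {..<card P} P"
      using P(1) ex_bij_betw_nat_finite[of P] by (auto simp: atLeast0LessThan)
    have cP: "c i \<in> P" if "i < card P" for i
      using c that by (auto simp: bij_betw_def)
    have "disjoint_family_on (\<lambda>i. cball (c i) (e / 2)) {..<card P}"
      unfolding disjoint_family_on_def
    proof (intro ballI impI)
      fix i j assume ij: "i \<in> {..<card P}" "j \<in> {..<card P}" "i \<noteq> j"
      then have "c i \<noteq> c j" using c by (auto simp: bij_betw_def inj_on_def)
      then have "e < dist (c i) (c j)"
        using ij cP P(3) by (auto dest: separatedD)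
      then have "\<not> (dist (c i) x \<le> e / 2 \<and> dist (c j) x \<le> e / 2)" for x
        using dist_triangle2[of "c i" "c j" x] by linarith
      then show "cball (c i) (e / 2) \<inter> cball (c j) (e / 2) = {}" by auto
    qed
    then have "(\<Sum>i. if i \<in> {..<card P} then ennreal ((2 * (e / 2)) powr s) else 0)
        \<le> packing_premeasure_delta s \<delta> E"
      by (intro packing_premeasure_delta_upper) (use e cP P in auto)
    also have "(\<Sum>i. if i \<in> {..<card P} then ennreal ((2 * (e / 2)) powr s) else 0)
        = (\<Sum>i<card P. ennreal (e powr s))"
      by (subst suminf_finite[where N = "{..<card P}"]) auto
    also have "\<dots> = ennreal (card P * e powr s)"
      by (subst sum_ennreal) auto
    also have "packing_premeasure_delta s \<delta> E = ennreal C"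
      unfolding C_def using \<delta> by simp
    finally have "card P * e powr s \<le> C"
      by (subst (asm) ennreal_le_iff) (auto simp: C_def)
    then show ?thesis
      using e by (simp add: powr_minus field_simps)
  qed
  with \<delta>(1) show ?thesis unfolding box_bounded_def by blast
qed

text \<open>Finitely many strict inequalities leave a common slack, so each point can be moved into
  \<open>S\<close> without destroying the separation.\<close>

lemma separated_approx_of_closure:
  assumes "finite P" "P \<subseteq> closure S" "separated e P" "0 < e"
  obtains Q where "finite Q" "Q \<subseteq> S" "separated e Q" "card Q = card P"
proof -
  have "\<exists>\<eta>>0. \<forall>x\<in>P. \<forall>y\<in>P. x \<noteq> y \<longrightarrow> e + 2 * \<eta> \<le> dist x y"
  proof -
    \<comment> \<open>The extra element \<open>e + 1\<close> keeps the set nonempty when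
      \<open>P\<close> has at most one point, so that \<open>Min ?D\<close> is meaningful.\<close>
    let ?D = "insert (e + 1) ((\<lambda>(x, y). dist x y) ` {(x, y) \<in> P \<times> P. x \<noteq> y})"
    have fin: "finite ?D" using assms(1)
      by (intro finite.insertI finite_imageI finite_subset[OF _ finite_cartesian_product[OF assms(1) assms(1)]]) auto
    have "e < Min ?D"
      using fin assms(3) by (subst Min_gr_iff) (auto dest: separatedD)
    moreover have "Min ?D \<le> dist x y" if "x \<in> P" "y \<in> P" "x \<noteq> y" for x y
      using fin that by (intro Min_le) (auto intro!: image_eqI[where x = "(x, y)"])
    ultimately obtain m where "e < m" "\<And>x y. x \<in> P \<Longrightarrow> y \<in> P \<Longrightarrow> x \<noteq> y \<Longrightarrow> m \<le> dist x y"
      by blast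
    then show ?thesis
      by (intro exI[where x = "(m - e) / 2"]) (auto simp: field_simps)
  qed
  then obtain \<eta> where \<eta>: "0 < \<eta>" "\<And>x y. x \<in> P \<Longrightarrow> y \<in> P \<Longrightarrow> x \<noteq> y \<Longrightarrow> e + 2 * \<eta> \<le> dist x y"
    by blast
  have "\<forall>x\<in>P. \<exists>y\<in>S. dist y x < \<eta>"
    using assms(2) \<eta>(1) by (auto simp: closure_approachable)
  then obtain q where q: "\<And>x. x \<in> P \<Longrightarrow> q x \<in> S" "\<And>x. x \<in> P \<Longrightarrow> dist (q x) x < \<eta>"
    by metis
  have sep: "e < dist (q x) (q y)" if "x \<in> P" "y \<in> P" "x \<noteq> y" for x y
  proof -
    have "dist x y \<le> dist (q x) x + (dist (q x) (q y) + dist (q y) y)"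
      by (smt (verit) dist_commute dist_triangle)
    then show ?thesis using \<eta>(2)[OF that] q(2)[OF that(1)] q(2)[OF that(2)] by linarith
  qed
  then have "inj_on q P"
    using assms(4) by (force simp: inj_on_def)
  show ?thesis
  proof
    show "card (q ` P) = card P" using \<open>inj_on q P\<close> by (rule card_image)
    show "separated e (q ` P)" using sep by (auto simp: separated_def)
  qed (use assms(1) q in auto)
qed

text \<open>Allows the pieces of a cover to be replaced by closed ones, as the Baire category
  theorem requires.\<close>

lemma box_bounded_closure:
  assumes "box_bounded s S"
  shows "box_bounded s (closure S)"
proof -
  obtain C \<delta> where "0 < \<delta>" and "\<forall>e P. 0 < e \<and> e \<le> \<delta> \<and> finite P \<and> P \<subseteq> S \<and>
      separated e P \<longrightarrow> real (card P) \<le> C * e powr (- s)"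
    using assms unfolding box_bounded_def by (elim exE conjE)
  note C = this(2)[rule_format, OF conjI, OF _ conjI, OF _ _ conjI, OF _ _ _ conjI]
  have "real (card P) \<le> C * e powr (- s)"
    if "0 < e" "e \<le> \<delta>" "finite P" "P \<subseteq> closure S" "separated e P" for e P
  proof -
    from separated_approx_of_closure[OF that(3-5,1)]
    obtain Q where "finite Q" "Q \<subseteq> S" "separated e Q" "card Q = card P" .
    then show ?thesis using C[OF that(1,2), of Q] by simp
  qed
  with \<open>0 < \<delta>\<close> show ?thesis unfolding box_bounded_def by blast
qed

lemma box_bounded_subset: "box_bounded s S \<Longrightarrow> T \<subseteq> S \<Longrightarrow> box_bounded s T"
  unfolding box_bounded_def by (meson subset_trans)

lemma box_bounded_mono_exponent:
  assumes "box_bounded s E" "s \<le> t"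
  shows "box_bounded t E"
proof -
  obtain C \<delta> where "0 < \<delta>" and C: "\<forall>e P. 0 < e \<and> e \<le> \<delta> \<and> finite P \<and> P \<subseteq> E \<and>
      separated e P \<longrightarrow> real (card P) \<le> C * e powr (- s)"
    using assms(1) unfolding box_bounded_def by (elim exE conjE)
  have "real (card P) \<le> max C 0 * e powr (- t)"
    if e: "0 < e" "e \<le> min \<delta> 1" and "finite P" "P \<subseteq> E" "separated e P" for e P
  proof -
    have "real (card P) \<le> C * e powr (- s)" using C that by simp
    also have "\<dots> \<le> max C 0 * e powr (- s)" by (intro mult_right_mono) auto
    also have "\<dots> \<le> max C 0 * e powr (- t)"
      using e assms(2) by (intro mult_left_mono powr_mono') auto
    finally show ?thesis .
  qed
  moreover have "0 < min \<delta> 1" using \<open>0 < \<delta>\<close> by simp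
  ultimately show ?thesis unfolding box_bounded_def by blast
qed

lemma packing_dim_nonneg: "0 \<le> packing_dim E"
  unfolding packing_dim_def by (intro Inf_greatest) auto

text \<open>The balls are sorted by dyadic size. At level \<open>n\<close> the centres are
  \<open>2 powr (- n - 1)\<close>-separated, so there are at most
  \<open>C * 2 powr (s * (n + 1))\<close> of them, each of weight at most
  \<open>2 powr (u * (1 - n))\<close>. The levels are dominated by a geometric series of ratio
  \<open>2 powr (s - u) < 1\<close>.\<close>

lemma packing_sum_bound:
  fixes I :: "nat set"
  assumes C: "\<And>e P. 0 < e \<Longrightarrow> e \<le> \<delta> \<Longrightarrow> finite P \<Longrightarrow> P \<subseteq> E \<Longrightarrow>
      separated e P \<Longrightarrow> real (card P) \<le> C * e powr (- s)"
    and \<delta>: "0 < \<delta>" "\<delta> \<le> 1" and u: "s < u" "0 \<le> u" and C0: "0 \<le> C"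
    and I: "finite I" "\<And>i. i \<in> I \<Longrightarrow> c i \<in> E \<and> 0 < r i \<and> r i \<le> \<delta>"
    and disj: "disjoint_family_on (\<lambda>i. cball (c i) (r i)) I"
  shows "(\<Sum>i\<in>I. (2 * r i) powr u) \<le> C * 2 powr (s + u) / (1 - 2 powr (s - u))"
proof -
  define k where "k i = nat \<lfloor>log 2 (1 / r i)\<rfloor>" for i
  have kr: "2 powr (- real (k i) - 1) < r i" "r i \<le> 2 powr (- real (k i))" if "i \<in> I" for i
  proof -
    have r: "0 < r i" "r i \<le> 1" using I(2)[OF that] \<delta> by auto
    then have l: "0 \<le> log 2 (1 / r i)" by simp
    have "real (k i) \<le> log 2 (1 / r i)" "log 2 (1 / r i) < real (k i) + 1"
      unfolding k_def using l by linarith+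
    then have "2 powr real (k i) \<le> 1 / r i" "1 / r i < 2 powr (real (k i) + 1)"
      using r by (auto simp: le_log_iff log_less_iff)
    then show "2 powr (- real (k i) - 1) < r i" "r i \<le> 2 powr (- real (k i))"
      using r by (auto simp: powr_minus powr_diff powr_add field_simps)
  qed
  have q: "0 < (2::real) powr (s - u)" "(2::real) powr (s - u) < 1"
    using u by (auto simp: powr_less_one)
  have level: "(\<Sum>i | i \<in> I \<and> k i = n. (2 * r i) powr u) \<le> C * 2 powr (s + u) * (2 powr (s - u)) ^ n" for n
  proof (cases "{i. i \<in> I \<and> k i = n} = {}")
    case True
    then show ?thesis using C0 by (simp only: True) auto
  next
    case False
    let ?J = "{i. i \<in> I \<and> k i = n}" and ?e = "2 powr (- real n - 1) :: real"
    have sep: "?e < dist (c i) (c j)" if "i \<in> ?J" "j \<in> ?J" "i \<noteq> j" for i j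
    proof -
      have "c j \<in> cball (c j) (r j)" using that I(2) by (auto simp: less_imp_le)
      then have "c j \<notin> cball (c i) (r i)"
        using disj that unfolding disjoint_family_on_def by blast
      then show ?thesis using kr(1)[of i] that by auto
    qed
    have inj: "inj_on c ?J"
      using sep by (force simp: inj_on_def)
    \<comment> \<open>The count is available only at scales up to \<open>\<delta>\<close>; any ball
      of this level has radius above \<open>?e\<close> and at most \<open>\<delta>\<close>.\<close>
    obtain i0 where "i0 \<in> ?J" using False by blast
    then have "?e \<le> \<delta>" using kr(1)[of i0] I(2)[of i0] by auto
    have "real (card (c ` ?J)) \<le> C * ?e powr (- s)"
      by (rule C) (use I \<open>?e \<le> \<delta>\<close> sep in \<open>auto simp: separated_def\<close>)
    then have cd: "real (card ?J) \<le> C * ?e powr (- s)" by (simp add: card_image inj)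
    have "(\<Sum>i\<in>?J. (2 * r i) powr u) \<le> (\<Sum>i\<in>?J. (2 * 2 powr (- real n)) powr u)"
      using kr(2) I(2) u by (intro sum_mono powr_mono2) (auto simp: less_imp_le)
    also have "\<dots> = card ?J * (2 * 2 powr (- real n)) powr u" by simp
    also have "\<dots> \<le> (C * ?e powr (- s)) * (2 * 2 powr (- real n)) powr u"
      using cd by (intro mult_right_mono) auto
    also have "?e powr (- s) = 2 powr (s * (real n + 1))"
      by (simp add: powr_powr algebra_simps)
    also have "(2 * 2 powr (- real n)) powr u = (2::real) powr (u * (1 - real n))"
    proof -
      have "2 * 2 powr (- real n) = (2::real) powr (1 - real n)"
        by (simp add: powr_diff powr_minus field_simps)
      then show ?thesis by (simp add: powr_powr algebra_simps)
    qed
    also have "(C * 2 powr (s * (real n + 1))) * 2 powr (u * (1 - real n))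
        = C * 2 powr (s + u) * (2 powr (s - u)) ^ n"
    proof -
      have "2 powr (s * (real n + 1)) * 2 powr (u * (1 - real n))
          = (2::real) powr ((s + u) + (s - u) * real n)"
        unfolding powr_add[symmetric] by (rule arg_cong[where f = "\<lambda>x. 2 powr x"]) (simp add: algebra_simps)
      also have "\<dots> = 2 powr (s + u) * (2 powr (s - u)) ^ n"
        by (simp add: powr_add powr_realpow[symmetric] powr_powr)
      finally show ?thesis by simp
    qed
    finally show ?thesis .
  qed
  have "(\<Sum>i\<in>I. (2 * r i) powr u) = (\<Sum>n\<in>k ` I. \<Sum>i | i \<in> I \<and> k i = n. (2 * r i) powr u)"
    using I(1) by (rule sum.image_gen)
  also have "\<dots> \<le> (\<Sum>n\<in>k ` I. C * 2 powr (s + u) * (2 powr (s - u)) ^ n)"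
    by (intro sum_mono level)
  also have "\<dots> \<le> (\<Sum>n. C * 2 powr (s + u) * (2 powr (s - u)) ^ n)"
    using I(1) q C0 by (intro sum_le_suminf summable_mult summable_geometric) auto
  also have "\<dots> = C * 2 powr (s + u) / (1 - 2 powr (s - u))"
    using q by (subst suminf_mult) (auto simp: suminf_geometric)
  finally show ?thesis .
qed

text \<open>With \<open>u\<close> halfway between \<open>s\<close> and \<open>s'\<close>, each
  weight splits as \<open>(2 * r) powr t * (2 * r) powr u\<close>. The sum over the second factor is
  bounded by the constant \<open>K\<close>, and the first factor is at most
  \<open>(2 * \<delta>) powr t\<close>, which tends to 0.\<close>

lemma packing_premeasure_eq_0_if_box_bounded:
  assumes "box_bounded s E" "s < s'" "0 \<le> s"
  shows "packing_premeasure s' E = 0"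
proof -
  obtain C' \<delta>' where d': "0 < \<delta>'" and "\<forall>e P. 0 < e \<and> e \<le> \<delta>' \<and> finite P \<and> P \<subseteq> E \<and>
      separated e P \<longrightarrow> real (card P) \<le> C' * e powr (- s)"
    using assms(1) unfolding box_bounded_def by (elim exE conjE)
  note C' = this(2)[rule_format, OF conjI, OF _ conjI, OF _ _ conjI, OF _ _ _ conjI]
  define \<delta>0 where "\<delta>0 = min \<delta>' 1"
  define C where "C = max C' 0"
  have C: "real (card P) \<le> C * e powr (- s)"
    if "0 < e" "e \<le> \<delta>0" "finite P" "P \<subseteq> E" "separated e P" for e P
  proof -
    have "real (card P) \<le> C' * e powr (- s)" using C' that by (auto simp: \<delta>0_def)
    also have "\<dots> \<le> C * e powr (- s)" by (intro mult_right_mono) (auto simp: C_def)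
    finally show ?thesis .
  qed
  define u t where "u = (s + s') / 2" and "t = (s' - s) / 2"
  have ut: "s < u" "0 \<le> u" "0 < t" "s' = t + u"
    using assms by (auto simp: u_def t_def field_simps)
  define K where "K = C * 2 powr (s + u) / (1 - 2 powr (s - u))"
  have K0: "0 \<le> K"
    unfolding K_def C_def
  proof (intro divide_nonneg_nonneg mult_nonneg_nonneg)
    have "(2::real) powr (s - u) < 1" using ut by (intro powr_less_one) auto
    then show "0 \<le> 1 - (2::real) powr (s - u)" by simp
  qed auto
  have bound: "packing_premeasure_delta s' \<delta> E \<le> ennreal ((2 * \<delta>) powr t * K)"
    if \<delta>: "0 < \<delta>" "\<delta> \<le> \<delta>0" for \<delta>
  proof (rule packing_premeasure_delta_least)
    fix I :: "nat set" and c r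
    assume I: "\<And>i. i \<in> I \<Longrightarrow> c i \<in> E \<and> 0 < r i \<and> r i \<le> \<delta>"
      and disj: "disjoint_family_on (\<lambda>i. cball (c i) (r i)) I"
    have "(\<Sum>i<n. if i \<in> I then ennreal ((2 * r i) powr s') else 0) \<le> ennreal ((2 * \<delta>) powr t * K)" for n
    proof -
      let ?J = "I \<inter> {..<n}"
      have "(\<Sum>i<n. if i \<in> I then ennreal ((2 * r i) powr s') else 0) = (\<Sum>i\<in>?J. ennreal ((2 * r i) powr s'))"
        by (subst sum.inter_restrict[symmetric]) (auto simp: Int_commute)
      also have "\<dots> = ennreal (\<Sum>i\<in>?J. (2 * r i) powr s')"
        by (rule sum_ennreal) auto
      also have "\<dots> \<le> ennreal ((2 * \<delta>) powr t * K)"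
      proof (rule ennreal_leI)
        have "(\<Sum>i\<in>?J. (2 * r i) powr s') \<le> (\<Sum>i\<in>?J. (2 * \<delta>) powr t * (2 * r i) powr u)"
          unfolding ut(4) powr_add using I ut(3)
          by (intro sum_mono mult_right_mono powr_mono2) (auto simp: less_imp_le)
        also have "\<dots> = (2 * \<delta>) powr t * (\<Sum>i\<in>?J. (2 * r i) powr u)"
          by (simp add: sum_distrib_left)
        also have "\<dots> \<le> (2 * \<delta>) powr t * K"
          unfolding K_def
        proof (intro mult_left_mono packing_sum_bound[where c = c and E = E and \<delta> = \<delta>])
          show "disjoint_family_on (\<lambda>i. cball (c i) (r i)) (I \<inter> {..<n})"
            by (rule disjoint_family_on_mono[OF _ disj]) auto
        qed (use C \<delta> I ut d' in \<open>auto simp: \<delta>0_def C_def\<close>)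
        finally show "(\<Sum>i\<in>?J. (2 * r i) powr s') \<le> (2 * \<delta>) powr t * K" .
      qed
      finally show ?thesis .
    qed
    then show "(\<Sum>i. if i \<in> I then ennreal ((2 * r i) powr s') else 0) \<le> ennreal ((2 * \<delta>) powr t * K)"
      by (intro suminf_le_const summableI) auto
  qed
  have "packing_premeasure s' E \<le> ennreal x" if "0 < x" for x
  proof -
    have "((\<lambda>\<delta>. (2 * \<delta>) powr t * K) \<longlongrightarrow> (2 * 0) powr t * K) (at_right 0)"
      using ut(3) by (intro tendsto_intros tendsto_powr') (auto simp: eventually_at_right_less intro: eventually_mono[OF eventually_at_right_less])
    then have "((\<lambda>\<delta>. (2 * \<delta>) powr t * K) \<longlongrightarrow> 0) (at_right 0)" using ut by simp
    then have "eventually (\<lambda>\<delta>. (2 * \<delta>) powr t * K < x) (at_right 0)"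
      using that by (rule order_tendstoD)
    moreover have "eventually (\<lambda>\<delta>::real. \<delta> \<in> {0<..<\<delta>0}) (at_right 0)"
      using d' by (intro eventually_at_right_real) (auto simp: \<delta>0_def)
    ultimately have "eventually (\<lambda>\<delta>. (2 * \<delta>) powr t * K < x \<and> \<delta> \<in> {0<..<\<delta>0}) (at_right 0)"
      by (rule eventually_conj)
    then obtain \<delta> where \<delta>: "(2 * \<delta>) powr t * K < x" "0 < \<delta>" "\<delta> < \<delta>0"
      using eventually_happens'[OF trivial_limit_at_right_real] by fastforce
    have "packing_premeasure s' E \<le> packing_premeasure_delta s' \<delta> E"
      unfolding packing_premeasure_def using \<delta> by (intro INF_lower) auto
    also have "\<dots> \<le> ennreal ((2 * \<delta>) powr t * K)" using \<delta> by (intro bound) auto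
    also have "\<dots> \<le> ennreal x" using \<delta> by (intro ennreal_leI) auto
    finally show ?thesis .
  qed
  then have "packing_premeasure s' E \<le> 0"
    by - (rule ennreal_le_epsilon, simp)
  then show ?thesis by simp
qed

section \<open>Countable stability of null sets and covers by closed sets\<close>

lemma packing_premeasure_empty: "packing_premeasure s ({} :: 'a::metric_space set) = 0"
proof -
  have "packing_premeasure_delta s 1 ({} :: 'a set) \<le> 0"
  proof (rule packing_premeasure_delta_least)
    fix I :: "nat set" and c :: "nat \<Rightarrow> 'a" and r :: "nat \<Rightarrow> real"
    assume "\<And>i. i \<in> I \<Longrightarrow> c i \<in> {} \<and> 0 < r i \<and> r i \<le> 1"
    then have "I = {}" by auto
    then show "(\<Sum>i. if i \<in> I then ennreal ((2 * r i) powr s) else 0) \<le> 0" by simp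
  qed
  moreover have "packing_premeasure s ({} :: 'a set) \<le> packing_premeasure_delta s 1 ({} :: 'a set)"
    unfolding packing_premeasure_def by (rule INF_lower[of "1::real"]) auto
  ultimately show ?thesis by simp
qed

lemma packing_measure_le_premeasure: "packing_measure s E \<le> packing_premeasure s E"
proof -
  let ?S = "\<lambda>i::nat. if i = 0 then E else {}"
  have "packing_measure s E \<le> (\<Sum>i. packing_premeasure s (?S i))"
    unfolding packing_measure_def by (intro INF_lower) (auto intro: exI[where x = 0])
  also have "\<dots> = packing_premeasure s E"
    by (subst suminf_finite[where N = "{0}"]) (auto simp: packing_premeasure_empty)
  finally show ?thesis .
qed

lemma packing_measure_eq_0_if_box_bounded:
  "box_bounded s E \<Longrightarrow> s < s' \<Longrightarrow> 0 \<le> s \<Longrightarrow> packing_measure s' E = 0"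
  using packing_measure_le_premeasure[of s' E] packing_premeasure_eq_0_if_box_bounded[of s E s']
  by simp

lemma packing_measure_mono: "E \<subseteq> F \<Longrightarrow> packing_measure s E \<le> packing_measure s F"
  unfolding packing_measure_def by (intro INF_superset_mono) auto

lemma packing_measure_UN_eq_0:
  fixes E :: "nat \<Rightarrow> 'a::metric_space set"
  assumes "\<And>n. packing_measure s (E n) = 0"
  shows "packing_measure s (\<Union>n. E n) = 0"
proof -
  have "packing_measure s (\<Union>n. E n) \<le> ennreal x" if x: "0 < x" for x
  proof -
    have "\<exists>S::nat \<Rightarrow> 'a set. E n \<subseteq> (\<Union>i. S i) \<and> (\<Sum>i. packing_premeasure s (S i)) < ennreal (x * (1/2)^Suc n)" for n
    proof -
      have "packing_measure s (E n) < ennreal (x * (1/2)^Suc n)"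
        using assms x by simp
      then show ?thesis unfolding packing_measure_def by (auto simp: INF_less_iff)
    qed
    then obtain S :: "nat \<Rightarrow> nat \<Rightarrow> 'a set" where S: "\<And>n. E n \<subseteq> (\<Union>i. S n i)"
      "\<And>n. (\<Sum>i. packing_premeasure s (S n i)) < ennreal (x * (1/2)^Suc n)"
      by metis
    let ?T = "\<lambda>k. case_prod S (prod_decode k)"
    have "(\<Union>n. E n) \<subseteq> (\<Union>k. ?T k)"
    proof
      fix y assume "y \<in> (\<Union>n. E n)"
      then obtain n i where "y \<in> S n i" using S(1) by blast
      then have "y \<in> ?T (prod_encode (n, i))" by simp
      then show "y \<in> (\<Union>k. ?T k)" by (rule UN_I[OF UNIV_I])
    qed
    then have "packing_measure s (\<Union>n. E n) \<le> (\<Sum>k. packing_premeasure s (?T k))"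
      unfolding packing_measure_def by (intro INF_lower) auto
    also have "\<dots> = (\<Sum>k. (\<lambda>(n, i). packing_premeasure s (S n i)) (prod_decode k))"
      by (auto simp: case_prod_beta)
    also have "\<dots> = (\<Sum>n. \<Sum>i. packing_premeasure s (S n i))"
      by (rule suminf_ennreal_2dimen) auto
    also have "\<dots> \<le> (\<Sum>n. ennreal (x * (1/2)^Suc n))"
      using S(2) by (intro suminf_le summableI) (auto simp: less_imp_le)
    also have "\<dots> = ennreal x"
    proof (rule suminf_ennreal_eq)
      show "(\<lambda>n. x * (1/2)^Suc n) sums x"
        using sums_mult[OF power_half_series, of x] by simp
    qed (use x in auto)
    finally show ?thesis .
  qed
  then have "packing_measure s (\<Union>n. E n) \<le> 0"
    by - (rule ennreal_le_epsilon, simp)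
  then show ?thesis by simp
qed

lemma packing_measure_Union_eq_0:
  assumes "countable \<E>" "\<And>E. E \<in> \<E> \<Longrightarrow> packing_measure s E = 0"
  shows "packing_measure s (\<Union>\<E>) = 0"
proof (cases "\<E> = {}")
  case True
  then show ?thesis
    using packing_measure_le_premeasure[of s "{}"] by (simp add: packing_premeasure_empty)
next
  case False
  then have "packing_measure s (\<Union>n. from_nat_into \<E> n) = 0"
    by (intro packing_measure_UN_eq_0 assms from_nat_into)
  then show ?thesis using False assms(1) by (simp add: range_from_nat_into)
qed

text \<open>A cover whose pre-measures sum to less than 1 has members of finite pre-measure; these
  are \<open>box_bounded s\<close>, and so are their closures.\<close>

lemma cover_of_packing_measure_eq_0:
  fixes E :: "'a::metric_space set"
  assumes "packing_measure s E = 0"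
  obtains S :: "nat \<Rightarrow> 'a set" where "E \<subseteq> (\<Union>i. S i)" "\<And>i. closed (S i)" "\<And>i. box_bounded s (S i)"
proof -
  have "packing_measure s E < 1" using assms by simp
  then obtain S :: "nat \<Rightarrow> 'a set" where S: "E \<subseteq> (\<Union>i. S i)" "(\<Sum>i. packing_premeasure s (S i)) < 1"
    unfolding packing_measure_def by (auto simp: INF_less_iff)
  have "packing_premeasure s (S i) < \<infinity>" for i
  proof -
    have "packing_premeasure s (S i) \<le> (\<Sum>i. packing_premeasure s (S i))"
      using sum_le_suminf[of "\<lambda>i. packing_premeasure s (S i)" "{i}"] by (simp add: summableI)
    also have "\<dots> < 1" by (rule S(2))
    also have "(1::ennreal) < \<infinity>" by simp
    finally show ?thesis .
  qed
  then have "box_bounded s (closure (S i))" for i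
    by (intro box_bounded_closure box_bounded_if_premeasure_finite)
  moreover have "E \<subseteq> (\<Union>i. closure (S i))" using S(1) closure_subset by blast
  ultimately show ?thesis using that[of "\<lambda>i. closure (S i)"] by auto
qed

section \<open>Analytic sets\<close>

text \<open>Discrete spaces are completely metrizable, and countable products preserve this.\<close>

lemma completely_metrizable_nat_fun: "completely_metrizable_space (euclidean :: (nat \<Rightarrow> nat) topology)"
proof -
  have "(euclidean :: nat topology) = discrete_topology UNIV"
    unfolding topology_eq by (auto intro: discrete_topology_class.open_discrete)
  then have "completely_metrizable_space (euclidean :: nat topology)"
    by (simp only: completely_metrizable_space_discrete_topology)
  then have "completely_metrizable_space (product_topology (\<lambda>_. euclidean :: nat topology) (UNIV :: nat set))"
    by (simp add: completely_metrizable_space_product_topology)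
  then show ?thesis
    by (simp only: euclidean_product_topology)
qed

text \<open>Discarding all basic open pieces of the Baire space with null image leaves a closed set
  on which the Baire category theorem applies to every cover of \<open>g ` A\<close>; the surviving pieces
  do not depend on \<open>g\<close>.\<close>
lemma analytic_set_countable_kernel:
  assumes "analytic_set A" "packing_measure \<gamma> A \<noteq> 0"
  obtains \<B> where "countable \<B>" "\<And>B. B \<in> \<B> \<Longrightarrow> packing_measure \<gamma> B \<noteq> 0"
    "\<And>(g :: real \<Rightarrow> 'b::metric_space) s. continuous_on UNIV g \<Longrightarrow> packing_measure s (g ` A) = 0 \<Longrightarrow>
      \<exists>B\<in>\<B>. box_bounded s (g ` B)"
proof -
  have "A \<noteq> {}"
    using assms(2) packing_measure_Union_eq_0[of "{}" \<gamma>] by auto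
  then obtain f :: "(nat \<Rightarrow> nat) \<Rightarrow> real" where f: "continuous_on UNIV f" "range f = A"
    using assms(1) unfolding analytic_set_def by blast
  obtain \<U> :: "(nat \<Rightarrow> nat) set set" where \<U>: "countable \<U>" "topological_basis \<U>"
    using ex_countable_basis by blast
  define \<N> where "\<N> = {U \<in> \<U>. packing_measure \<gamma> (f ` U) = 0}"
  define F where "F = - \<Union>\<N>"
  have cN: "countable \<N>" using \<U>(1) by (auto simp: \<N>_def intro: countable_subset)
  have "closed F"
    unfolding F_def \<N>_def using topological_basis_open[OF \<U>(2)] by (auto intro!: open_Union)
  have null: "packing_measure \<gamma> (f ` \<Union>\<N>) = 0"
    unfolding image_Union
    by (rule packing_measure_Union_eq_0) (use cN in \<open>auto simp: \<N>_def\<close>)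
  \<comment> \<open>The part of \<open>U\<close> outside \<open>F\<close> lies in the discarded
    union, whose image is null. If \<open>U \<inter> F\<close> also had null image, \<open>U\<close>
    itself would have been discarded.\<close>
  have nonnull: "packing_measure \<gamma> (f ` (U \<inter> F)) \<noteq> 0" if U: "U \<in> \<U>" "U \<inter> F \<noteq> {}" for U
  proof
    assume "packing_measure \<gamma> (f ` (U \<inter> F)) = 0"
    then have "packing_measure \<gamma> (\<Union>{f ` (U \<inter> F), f ` \<Union>\<N>}) = 0"
      by (intro packing_measure_Union_eq_0) (use null in auto)
    moreover have "f ` U \<subseteq> \<Union>{f ` (U \<inter> F), f ` \<Union>\<N>}" by (auto simp: F_def)
    ultimately have "packing_measure \<gamma> (f ` U) = 0"
      using packing_measure_mono by (metis le_zero_eq)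
    then have "U \<in> \<N>" using U by (auto simp: \<N>_def)
    then show False using U by (auto simp: F_def)
  qed
  have "F \<noteq> {}"
  proof
    assume "F = {}"
    then have "\<Union>\<N> = UNIV" unfolding F_def by (metis Compl_empty_eq double_complement)
    then have "f ` \<Union>\<N> = A" using f(2) by simp
    then show False using null assms(2) by simp
  qed
  show ?thesis
  proof (rule that[of "(\<lambda>U. f ` (U \<inter> F)) ` {U \<in> \<U>. U \<inter> F \<noteq> {}}"])
    fix g :: "real \<Rightarrow> 'b" and s
    assume g: "continuous_on UNIV g" "packing_measure s (g ` A) = 0"
    obtain S :: "nat \<Rightarrow> 'b set" where S: "g ` A \<subseteq> (\<Union>i. S i)" "\<And>i. closed (S i)" "\<And>i. box_bounded s (S i)"
      using cover_of_packing_measure_eq_0[OF g(2)] by blast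
    \<comment> \<open>The sets \<open>T i\<close> are relatively closed and cover \<open>F\<close>,
      so by Baire category one of them has interior in \<open>F\<close>; a basic open
      \<open>U\<close> inside it gives the required piece.\<close>
    define T where "T i = F \<inter> (g \<circ> f) -` S i" for i
    have cont: "continuous_on UNIV (g \<circ> f)"
      by (intro continuous_on_compose f(1) continuous_on_subset[OF g(1)]) auto
    have closedT: "closedin (top_of_set F) (T i)" for i
      unfolding T_def using closed_vimage[OF S(2) cont] by (simp add: closedin_closed_Int)
    have "\<exists>i. g (f x) \<in> S i" for x using S(1) f(2) by blast
    then have "\<Union>(range T) = F" by (auto simp: T_def)
    then have ne: "top_of_set F interior_of \<Union>(range T) \<noteq> {}"
      using \<open>F \<noteq> {}\<close> interior_of_topspace[of "top_of_set F"] by simp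
    have "completely_metrizable_space (top_of_set F)"
      by (rule completely_metrizable_space_closedin[OF completely_metrizable_nat_fun])
        (use \<open>closed F\<close> in \<open>simp only: closed_closedin\<close>)
    then obtain i where "top_of_set F interior_of T i \<noteq> {}"
      using ne Baire_category_alt[of "top_of_set F" "range T"] closedT by auto
    then obtain x V where "openin (top_of_set F) V" "x \<in> V" "V \<subseteq> T i"
      by (auto simp: interior_of_def)
    then obtain W where W: "open W" "x \<in> W" "x \<in> F" "F \<inter> W \<subseteq> T i"
      by (auto simp: openin_open)
    then obtain U where U: "U \<in> \<U>" "x \<in> U" "U \<subseteq> W"
      using topological_basisE[OF \<U>(2)] by metis
    have "g ` f ` (U \<inter> F) \<subseteq> S i" using U W(4) by (auto simp: T_def)
    then have "box_bounded s (g ` f ` (U \<inter> F))" using S(3) box_bounded_subset by blast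
    then show "\<exists>B\<in>(\<lambda>U. f ` (U \<inter> F)) ` {U \<in> \<U>. U \<inter> F \<noteq> {}}. box_bounded s (g ` B)"
      using U W(3) by blast
  qed (use \<U>(1) nonnull in auto)
qed

section \<open>Separated sets of reals\<close>

text \<open>Consecutive points are more than \<open>r\<close> apart and there are
  \<open>card Q - 1\<close> gaps; the induction adds the largest point.\<close>

lemma separated_real_card_le:
  fixes Q :: "real set"
  assumes "finite Q" "Q \<noteq> {}" "separated r Q"
  shows "(real (card Q) - 1) * r \<le> Max Q - Min Q"
  using assms
proof (induction Q rule: finite_linorder_max_induct)
  case (insert b A)
  show ?case
  proof (cases "A = {}")
    case False
    have "(real (card A) - 1) * r \<le> Max A - Min A"
      using insert False by (auto intro: separated_mono)
    moreover have "Max A \<in> A" "Min A \<in> A" using insert False by auto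
    moreover from this have Mm: "r < dist b (Max A)" "Max A < b" "Min A < b"
      using insert.hyps by (auto intro!: separatedD[OF insert.prems(2)])
    moreover have "Max (insert b A) = b" "Min (insert b A) = Min A" "card (insert b A) = Suc (card A)"
      using insert.hyps False Mm(2,3) by (simp_all add: less_imp_le) (metis less_irrefl card_insert_disjoint)
    ultimately show ?thesis
      by (simp add: algebra_simps dist_real_def)
  qed simp
qed simp

lemma separated_real_card_le_interval:
  fixes Q :: "real set"
  assumes "finite Q" "x \<in> Q" "separated r Q" "\<And>t. t \<in> Q \<Longrightarrow> \<bar>t - x\<bar> \<le> h"
  shows "real (card (Q - {x})) * r \<le> 2 * h"
proof -
  have "Q \<noteq> {}" using assms(2) by auto
  then have "Max Q \<in> Q" "Min Q \<in> Q" using assms(1) by simp_all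
  then have "Max Q - Min Q \<le> 2 * h" using assms(4)[of "Max Q"] assms(4)[of "Min Q"] by linarith
  moreover have "card Q = Suc (card (Q - {x}))"
    using assms(1,2) by (rule card.remove)
  then have "real (card Q) - 1 = real (card (Q - {x}))" by simp
  ultimately show ?thesis using separated_real_card_le[OF assms(1) \<open>Q \<noteq> {}\<close> assms(3)] by simp
qed

text \<open>By concavity, the increment of \<open>x powr b\<close> over a unit interval is at least
  the derivative at its right end.\<close>

lemma powr_concave_step:
  fixes x b :: real
  assumes "1 \<le> x" "0 < b" "b < 1"
  shows "(x - 1) powr b + b * x powr (b - 1) \<le> x powr b"
\<comment> \<open>At \<open>x = 1\<close> the interval starts at 0, where the power is not
  differentiable.\<close>
proof (cases "x = 1")
  case True
  then show ?thesis using assms by simp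
next
  case False
  have "\<exists>z. x - 1 < z \<and> z < x \<and> x powr b - (x - 1) powr b = (x - (x - 1)) * (b * z powr (b - 1))"
    by (rule MVT2) (use assms False in \<open>auto intro!: derivative_eq_intros\<close>)
  then obtain z where z: "x - 1 < z" "z < x" "x powr b - (x - 1) powr b = b * z powr (b - 1)"
    by auto
  have "x powr (b - 1) \<le> z powr (b - 1)"
    using z assms False by (intro powr_mono2') auto
  then have "b * x powr (b - 1) \<le> b * z powr (b - 1)" using assms by (intro mult_left_mono) auto
  then show ?thesis using z(3) by linarith
qed

text \<open>Ordered by distance from \<open>x\<close>, the \<open>k\<close>-th other point is at
  distance at least \<open>k * r / 2\<close>, and the sum of \<open>k powr (- a)\<close> up to
  \<open>N\<close> is at most \<open>N powr (1 - a) / (1 - a)\<close>. The induction removes the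
  farthest point.\<close>

lemma sum_inverse_dist_le:
  fixes Q :: "real set"
  assumes "0 < r" "0 < a" "a < 1" "finite Q" "x \<in> Q" "separated r Q"
  shows "(\<Sum>t\<in>Q - {x}. \<bar>t - x\<bar> powr (- a))
    \<le> 2 powr a / (1 - a) * r powr (- a) * real (card (Q - {x})) powr (1 - a)"
  using assms(4-6)
proof (induction "card (Q - {x})" arbitrary: Q)
  case 0
  then have "Q - {x} = {}" by (metis card_0_eq finite_Diff)
  then show ?case by (simp only: sum.empty card.empty) simp
next
  case (Suc n)
  have fin: "finite (Q - {x})" and ne: "Q - {x} \<noteq> {}"
    using Suc.prems(1) Suc(2) by (simp, metis card.empty nat.distinct(1))
  obtain t where t: "t \<in> Q - {x}" "\<And>u. u \<in> Q - {x} \<Longrightarrow> \<bar>u - x\<bar> \<le> \<bar>t - x\<bar>"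
  proof -
    have "Max ((\<lambda>u. \<bar>u - x\<bar>) ` (Q - {x})) \<in> (\<lambda>u. \<bar>u - x\<bar>) ` (Q - {x})"
      using fin ne by (intro Max_in) auto
    moreover have "\<bar>u - x\<bar> \<le> Max ((\<lambda>u. \<bar>u - x\<bar>) ` (Q - {x}))" if "u \<in> Q - {x}" for u
      using fin that by (intro Max_ge finite_imageI imageI)
    ultimately show ?thesis using that by (metis (no_types, lifting) imageE)
  qed
  define K where "K = 2 powr a / (1 - a) * r powr (- a)"
  have cd: "card (Q - {t} - {x}) = n"
  proof -
    have "Q - {t} - {x} = Q - {x} - {t}" by auto
    then show ?thesis using Suc(2) t fin by simp
  qed
  have IH: "(\<Sum>t\<in>Q - {t} - {x}. \<bar>t - x\<bar> powr (- a)) \<le> K * real n powr (1 - a)"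
    unfolding K_def using Suc(1)[of "Q - {t}"] cd Suc.prems t by (auto intro: separated_mono)
  have "real (Suc n) * r \<le> 2 * \<bar>t - x\<bar>"
    unfolding Suc(2)
  proof (rule separated_real_card_le_interval)
    show "\<bar>u - x\<bar> \<le> \<bar>t - x\<bar>" if "u \<in> Q" for u
      using t(2)[of u] that by (cases "u = x") auto
  qed (use Suc.prems in auto)
  then have "real (Suc n) * r / 2 \<le> \<bar>t - x\<bar>" by simp
  then have "\<bar>t - x\<bar> powr (- a) \<le> (real (Suc n) * r / 2) powr (- a)"
    using assms by (intro powr_mono2') auto
  also have "\<dots> = K * ((1 - a) * real (Suc n) powr (- a))"
  proof -
    have "(y * r / 2) powr (- a) = 2 powr a * r powr (- a) * y powr (- a)" if "0 \<le> y" for y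
      using that assms(1) by (simp add: powr_mult powr_divide powr_minus field_simps)
    then show ?thesis using assms(3) by (simp add: K_def)
  qed
  finally have tx: "\<bar>t - x\<bar> powr (- a) \<le> K * ((1 - a) * real (Suc n) powr (- a))" .
  have "(\<Sum>t\<in>Q - {x}. \<bar>t - x\<bar> powr (- a))
      = \<bar>t - x\<bar> powr (- a) + (\<Sum>t\<in>Q - {x} - {t}. \<bar>t - x\<bar> powr (- a))"
    using fin t(1) by (rule sum.remove)
  also have "Q - {x} - {t} = Q - {t} - {x}" by auto
  also have "\<bar>t - x\<bar> powr (- a) + (\<Sum>t\<in>Q - {t} - {x}. \<bar>t - x\<bar> powr (- a))
      \<le> K * ((1 - a) * real (Suc n) powr (- a)) + K * real n powr (1 - a)"
    using IH tx by linarith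
  \<comment> \<open>Writing \<open>n\<close> as \<open>Suc n - 1\<close> gives the form of
    \<open>powr_concave_step\<close> with exponent \<open>1 - a\<close>.\<close>
  also have "\<dots> = K * ((real (Suc n) - 1) powr (1 - a) + (1 - a) * real (Suc n) powr (1 - a - 1))"
    by (simp add: algebra_simps)
  also have "\<dots> \<le> K * real (Suc n) powr (1 - a)"
    by (intro mult_left_mono powr_concave_step) (use assms in \<open>auto simp: K_def\<close>)
  finally show ?case unfolding K_def Suc(2) .
qed

section \<open>Large separated subsets from few close pairs\<close>

text \<open>A maximal \<open>Q\<close> with \<open>e\<close>-separated image is also an
  \<open>e\<close>-net. Sending each point to a nearby centre partitions \<open>P\<close> into
  \<open>card Q\<close> cells, two points of a cell have images within \<open>2 * e\<close>, and
  Cauchy-Schwarz compares the sum of the cell sizes with the sum of their squares.\<close>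

lemma exists_large_separated_subset:
  fixes g :: "'i \<Rightarrow> 'a::metric_space"
  assumes "finite P" "0 < e"
  obtains Q where "Q \<subseteq> P" "inj_on g Q" "separated e (g ` Q)"
    "(card P)\<^sup>2 \<le> card Q * card {(s, t) \<in> P \<times> P. dist (g s) (g t) \<le> 2 * e}"
proof -
  define \<S> where "\<S> = {Q. Q \<subseteq> P \<and> (\<forall>x\<in>Q. \<forall>y\<in>Q. x \<noteq> y \<longrightarrow> e < dist (g x) (g y))}"
  have "finite \<S>" using assms(1) by (auto simp: \<S>_def)
  moreover have "{} \<in> \<S>" by (auto simp: \<S>_def)
  ultimately obtain Q where Q: "Q \<in> \<S>" "\<And>R. R \<in> \<S> \<Longrightarrow> Q \<subseteq> R \<Longrightarrow> R = Q"
    using finite_has_maximal2[of \<S> "{}"] by metis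
  have QP: "Q \<subseteq> P" using Q(1) by (auto simp: \<S>_def)
  then have finQ: "finite Q" using assms(1) finite_subset by blast
  have "\<exists>c\<in>Q. dist (g t) (g c) \<le> e" if "t \<in> P" for t
  proof (rule ccontr)
    assume far: "\<not> (\<exists>c\<in>Q. dist (g t) (g c) \<le> e)"
    then have "insert t Q \<in> \<S>" using Q(1) that by (auto simp: \<S>_def dist_commute not_le)
    then have "t \<in> Q" using Q(2) by blast
    then show False using far assms(2) by force
  qed
  then obtain \<phi> where \<phi>: "\<And>t. t \<in> P \<Longrightarrow> \<phi> t \<in> Q" "\<And>t. t \<in> P \<Longrightarrow> dist (g t) (g (\<phi> t)) \<le> e"
    by metis
  let ?a = "\<lambda>c. {t \<in> P. \<phi> t = c}"
  have "card P = (\<Sum>c\<in>Q. card (?a c))"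
  proof -
    have "P = (\<Union>c\<in>Q. ?a c)" using \<phi>(1) by auto
    also have "card \<dots> = (\<Sum>c\<in>Q. card (?a c))"
      by (rule card_UN_disjoint) (use finQ assms(1) in auto)
    finally show ?thesis .
  qed
  then have "(real (card P))\<^sup>2 = (\<Sum>c\<in>Q. real (card (?a c)))\<^sup>2" by simp
  also have "\<dots> \<le> (\<Sum>c\<in>Q. (real (card (?a c)))\<^sup>2) * card Q"
    by (rule sum_squared_le_sum_of_squares)
  also have "(\<Sum>c\<in>Q. (real (card (?a c)))\<^sup>2) = real (card (\<Union>c\<in>Q. ?a c \<times> ?a c))"
    by (subst card_UN_disjoint) (use finQ assms(1) in \<open>auto simp: power2_eq_square card_cartesian_product\<close>)
  also have "card (\<Union>c\<in>Q. ?a c \<times> ?a c) \<le> card {(s, t) \<in> P \<times> P. dist (g s) (g t) \<le> 2 * e}"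
  proof (rule card_mono)
    show "finite {(s, t) \<in> P \<times> P. dist (g s) (g t) \<le> 2 * e}"
      using assms(1) by (auto intro: finite_subset[OF _ finite_cartesian_product[OF assms(1) assms(1)]])
    have "dist (g s) (g t) \<le> 2 * e" if "s \<in> P" "t \<in> P" "\<phi> s = \<phi> t" for s t
      using \<phi>(2)[OF that(1)] \<phi>(2)[OF that(2)] that(3) dist_triangle2[of "g s" "g t" "g (\<phi> t)"]
      by simp
    then show "(\<Union>c\<in>Q. ?a c \<times> ?a c) \<subseteq> {(s, t) \<in> P \<times> P. dist (g s) (g t) \<le> 2 * e}" by auto
  qed
  finally have "(real (card P))\<^sup>2 \<le> real (card {(s, t) \<in> P \<times> P. dist (g s) (g t) \<le> 2 * e}) * real (card Q)"
    by (simp add: mult_right_mono)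
  then have "(card P)\<^sup>2 \<le> card Q * card {(s, t) \<in> P \<times> P. dist (g s) (g t) \<le> 2 * e}"
    unfolding of_nat_power[symmetric] of_nat_mult[symmetric] of_nat_le_iff by (simp only: mult.commute)
  moreover have "inj_on g Q" "separated e (g ` Q)"
    using Q(1) assms(2) by (force simp: \<S>_def inj_on_def separated_def)+
  ultimately show ?thesis using that QP by blast
qed

section \<open>Small increments of fractional Brownian motion\<close>

text \<open>The coordinatewise bound lets independence factor the probability; the condition on the
  times confines sums to nearby times.\<close>

definition close_event :: "'w measure \<Rightarrow> ('w \<Rightarrow> real \<Rightarrow> real ^ 'd) \<Rightarrow> real \<Rightarrow> real \<Rightarrow> real \<Rightarrow> 'w set" where
  "close_event M X u s t =
     {\<omega> \<in> space M. \<bar>t - s\<bar> \<le> u \<and> (\<forall>i. \<bar>X \<omega> t $ i - X \<omega> s $ i\<bar> \<le> u)}"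

text \<open>The increment is the linear combination with coefficients 1 and -1, whose variance
  follows from the covariance.\<close>

lemma fbm_increment_gaussian:
  assumes "fbm M \<alpha> X" "0 < \<alpha>"
  shows "real_gaussian M (\<lambda>\<omega>. X \<omega> t $ i - X \<omega> s $ i) 0 (\<bar>t - s\<bar> powr (2 * \<alpha>))"
proof -
  have "centered_gaussian_process M (\<lambda>\<omega> t. X \<omega> t $ i) (fbm_cov \<alpha>)"
    using assms(1) by (simp add: fbm_def)
  note this[unfolded centered_gaussian_process_def, THEN spec, of 2, THEN spec,
    of "\<lambda>k. if k = 0 then t else s", THEN spec, of "\<lambda>k. if k = 0 then 1 else - 1"]
  moreover have "\<bar>s - t\<bar> = \<bar>t - s\<bar>" by simp
  ultimately show ?thesis
    using assms(2) by (simp add: numeral_2_eq_2 fbm_cov_def field_simps)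
qed

lemma close_event_sets:
  fixes X :: "'w \<Rightarrow> real \<Rightarrow> real ^ 'd"
  assumes "fbm M \<alpha> X" "0 < \<alpha>"
  shows "close_event M X u s t \<in> sets M"
proof -
  have [measurable]: "(\<lambda>\<omega>. X \<omega> t $ i - X \<omega> s $ i) \<in> borel_measurable M" for i
    using fbm_increment_gaussian[OF assms] by (simp add: real_gaussian_def)
  show ?thesis
    unfolding close_event_def by measurable
qed

text \<open>Uses \<open>2 * pi \<ge> 4\<close>. Integrated over an interval of length
  \<open>2 * u\<close>, this bound gives exactly \<open>u / \<sigma>\<close>.\<close>

lemma normal_density_le:
  assumes "0 < \<sigma>"
  shows "normal_density \<mu> \<sigma> x \<le> 1 / (2 * \<sigma>)"
proof -
  have "2 * \<sigma> = sqrt (4 * \<sigma>\<^sup>2)" using assms by (simp add: real_sqrt_mult)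
  also have "\<dots> \<le> sqrt (2 * pi * \<sigma>\<^sup>2)"
    using pi_gt3 by (intro real_sqrt_le_mono mult_right_mono) auto
  finally have "2 * \<sigma> \<le> sqrt (2 * pi * \<sigma>\<^sup>2)" .
  then have "1 / sqrt (2 * pi * \<sigma>\<^sup>2) \<le> 1 / (2 * \<sigma>)"
    using assms by (intro divide_left_mono mult_pos_pos) auto
  moreover have "exp (- (x - \<mu>)\<^sup>2 / (2 * \<sigma>\<^sup>2)) \<le> 1" by simp
  ultimately show ?thesis
    unfolding normal_density_def using assms
    by (smt (verit) divide_nonneg_nonneg mult_left_le real_sqrt_ge_zero exp_ge_zero mult_nonneg_nonneg pi_ge_zero zero_le_power2)
qed

lemma gaussian_small_ball:
  assumes "prob_space M" "real_gaussian M Y 0 v" "0 < v" "0 \<le> u"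
  shows "measure M (Y -` {- u..u} \<inter> space M) \<le> u / sqrt v"
proof -
  interpret prob_space M by fact
  have D: "distributed M lborel Y (normal_density 0 (sqrt v))"
    using assms by (auto simp: real_gaussian_def)
  have "emeasure M (Y -` {- u..u} \<inter> space M)
      = (\<integral>\<^sup>+ x. ennreal (normal_density 0 (sqrt v) x) * indicator {- u..u} x \<partial>lborel)"
    by (rule distributed_emeasure[OF D]) simp
  also have "\<dots> \<le> (\<integral>\<^sup>+ x. ennreal (1 / (2 * sqrt v)) * indicator {- u..u} x \<partial>lborel)"
    using assms by (intro nn_integral_mono mult_right_mono ennreal_leI normal_density_le) auto
  also have "\<dots> = ennreal (1 / (2 * sqrt v)) * ennreal (2 * u)"
    using assms by (subst nn_integral_cmult_indicator) auto
  also have "\<dots> = ennreal (u / sqrt v)"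
    using assms by (subst ennreal_mult[symmetric]) auto
  finally show ?thesis
    using assms by (auto simp: emeasure_eq_measure ennreal_le_iff)
qed

text \<open>Each coordinate increment has standard deviation
  \<open>\<bar>t - s\<bar> powr \<alpha>\<close>, so it is at most \<open>u\<close> in absolute
  value with probability at most \<open>u * \<bar>t - s\<bar> powr (- \<alpha>)\<close>; by
  independence the bounds multiply.\<close>

lemma close_event_prob_le:
  fixes X :: "'w \<Rightarrow> real \<Rightarrow> real ^ 'd"
  assumes "fbm M \<alpha> X" "0 < \<alpha>" "s \<noteq> t" "0 \<le> u"
  shows "measure M (close_event M X u s t)
    \<le> u ^ CARD('d) * \<bar>t - s\<bar> powr (- (\<alpha> * real CARD('d)))"
proof -
  have ps: "prob_space M" using assms(1) by (simp add: fbm_def)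
  interpret prob_space M by fact
  let ?D = "\<lambda>i \<omega>. X \<omega> t $ i - X \<omega> s $ i"
  have "indep_vars (\<lambda>_. Pi\<^sub>M UNIV (\<lambda>_. borel)) (\<lambda>i \<omega>. (\<lambda>t. X \<omega> t $ i)) UNIV"
    using assms(1) by (simp add: fbm_def)
  then have ind: "indep_vars (\<lambda>_. borel) ?D UNIV"
    by (rule indep_vars_compose2[where Y = "\<lambda>_ f. f t - f s"]) measurable
  have single: "prob (?D i -` {- u..u} \<inter> space M) \<le> u * \<bar>t - s\<bar> powr (- \<alpha>)" for i
  proof -
    have "sqrt (\<bar>t - s\<bar> powr (2 * \<alpha>)) = \<bar>t - s\<bar> powr \<alpha>"
      using powr_half_sqrt_powr[of "\<bar>t - s\<bar>" "2 * \<alpha>"] by simp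
    then show ?thesis
      using gaussian_small_ball[OF ps fbm_increment_gaussian[OF assms(1,2)], of t s u i] assms
      by (simp add: powr_minus divide_inverse)
  qed
  have "close_event M X u s t \<subseteq> (\<Inter>i\<in>UNIV. ?D i -` {- u..u} \<inter> space M)"
    by (auto simp: close_event_def abs_le_iff) (smt (verit))+
  then have "prob (close_event M X u s t) \<le> prob (\<Inter>i\<in>UNIV. ?D i -` {- u..u} \<inter> space M)"
    using ind unfolding indep_vars_def
    by (intro finite_measure_mono sets.finite_INT) (auto intro!: measurable_sets)
  also have "\<dots> = (\<Prod>i\<in>UNIV. prob (?D i -` {- u..u} \<inter> space M))"
    by (rule indep_varsD_finite[OF ind]) auto
  also have "\<dots> \<le> (\<Prod>i\<in>(UNIV :: 'd set). u * \<bar>t - s\<bar> powr (- \<alpha>))"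
    by (intro prod_mono conjI single) auto
  also have "\<dots> = u ^ CARD('d) * (\<bar>t - s\<bar> powr (- \<alpha>)) ^ CARD('d)"
    by (simp add: power_mult_distrib)
  also have "(\<bar>t - s\<bar> powr (- \<alpha>)) ^ CARD('d) = \<bar>t - s\<bar> powr (- (\<alpha> * real CARD('d)))"
    using assms by (simp add: powr_realpow[symmetric] powr_powr)
  finally show ?thesis .
qed

text \<open>The summand 1 accounts for \<open>t = x\<close>; the other times are handled by
  \<open>close_event_prob_le\<close> and \<open>sum_inverse_dist_le\<close>.\<close>

lemma sum_close_event_prob_le:
  fixes X :: "'w \<Rightarrow> real \<Rightarrow> real ^ 'd"
  assumes "fbm M \<alpha> X" "0 < \<alpha>" "\<alpha> * real CARD('d) < 1" "0 \<le> u" "0 < r"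
    and Q: "finite Q" "x \<in> Q" "separated r Q"
  defines "a \<equiv> \<alpha> * real CARD('d)"
  shows "(\<Sum>t\<in>Q. measure M (close_event M X u x t))
    \<le> 1 + u ^ CARD('d) * (2 powr a / (1 - a) * r powr (- a) * real (card (Q - {x})) powr (1 - a))"
proof -
  interpret prob_space M using assms(1) by (simp add: fbm_def)
  have "0 < a" using assms by simp
  have "(\<Sum>t\<in>Q. prob (close_event M X u x t))
      = prob (close_event M X u x x) + (\<Sum>t\<in>Q - {x}. prob (close_event M X u x t))"
    using Q(1,2) by (rule sum.remove)
  also have "\<dots> \<le> 1 + (\<Sum>t\<in>Q - {x}. u ^ CARD('d) * \<bar>t - x\<bar> powr (- a))"
    unfolding a_def using assms by (intro add_mono sum_mono close_event_prob_le prob_le_1) auto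
  also have "(\<Sum>t\<in>Q - {x}. u ^ CARD('d) * \<bar>t - x\<bar> powr (- a))
      = u ^ CARD('d) * (\<Sum>t\<in>Q - {x}. \<bar>t - x\<bar> powr (- a))"
    by (simp add: sum_distrib_left)
  also have "\<dots> \<le> u ^ CARD('d) * (2 powr a / (1 - a) * r powr (- a) * real (card (Q - {x})) powr (1 - a))"
    using assms \<open>0 < a\<close> by (intro mult_left_mono sum_inverse_dist_le) (auto simp: a_def)
  finally show ?thesis by simp
qed

section \<open>From large sets of times to large separated sets in the graph\<close>

text \<open>The constant 1 fails at some scale below \<open>\<delta>\<close>. Points are then
  discarded until the ceiling of \<open>r powr (- \<gamma>)\<close> remain, which is at most twice
  that value because \<open>r \<le> 1\<close>; the upper bound controls the expected number of close
  pairs.\<close>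

lemma not_box_bounded_scales:
  assumes "\<not> box_bounded \<gamma> B" "0 < \<delta>" "\<delta> \<le> 1" "0 < \<gamma>"
  obtains r P where "0 < r" "r \<le> \<delta>" "finite P" "P \<subseteq> B" "separated r P"
    "r powr (- \<gamma>) \<le> real (card P)" "real (card P) \<le> 2 * r powr (- \<gamma>)"
proof -
  obtain r P' where P': "0 < r" "r \<le> \<delta>" "finite P'" "P' \<subseteq> B" "separated r P'"
      "r powr (- \<gamma>) < real (card P')"
    using assms(1,2) unfolding box_bounded_def by (metis mult_1 not_le)
  define N where "N = nat \<lceil>r powr (- \<gamma>)\<rceil>"
  have "1 \<le> r powr (- \<gamma>)"
    using P' assms powr_mono2'[of "- \<gamma>" r 1] by simp
  then have N: "r powr (- \<gamma>) \<le> real N" "real N \<le> 2 * r powr (- \<gamma>)"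
    unfolding N_def by linarith+
  have "N \<le> card P'" unfolding N_def using P'(6) by (simp add: nat_le_iff ceiling_le_iff)
  then obtain P where "P \<subseteq> P'" "card P = N" "finite P"
    using obtain_subset_with_card_n by metis
  then show ?thesis using that[of r P] P' N by (meson order_trans separated_mono)
qed

text \<open>The intersection of the \<open>E n\<close> with \<open>n \<ge> k\<close> lies in each of
  them, so its measure is at most the limit 0. Good behaviour at infinitely many scales suffices to
  refute \<open>box_bounded\<close>.\<close>

lemma AE_infinitely_often_not:
  assumes "prob_space M" "\<And>n. E n \<in> sets M" "(\<lambda>n. measure M (E n)) \<longlonglongrightarrow> 0"
  shows "AE \<omega> in M. \<forall>k. \<exists>n\<ge>k::nat. \<omega> \<notin> E n"
proof -
  interpret prob_space M by fact
  have "AE \<omega> in M. \<exists>n\<ge>k. \<omega> \<notin> E n" for k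
  proof (rule AE_I')
    have meas: "(\<Inter>n\<in>{k..}. E n) \<in> sets M" using assms(2) by (intro sets.countable_INT') auto
    have "prob (\<Inter>n\<in>{k..}. E n) \<le> 0"
    proof (rule LIMSEQ_le_const[OF assms(3)])
      show "\<exists>N. \<forall>n\<ge>N. prob (\<Inter>n\<in>{k..}. E n) \<le> prob (E n)"
        using assms(2) by (intro exI[of _ k] allI impI finite_measure_mono) auto
    qed
    then show "(\<Inter>n\<in>{k..}. E n) \<in> null_sets M"
      using meas by (auto simp: null_sets_def emeasure_eq_measure measure_le_0_iff)
  qed auto
  then show ?thesis by (simp add: AE_all_countable)
qed

lemma dist_graph_map_imp_close_event:
  assumes "\<omega> \<in> space M" "dist (graph_map (X \<omega>) s) (graph_map (X \<omega>) t) \<le> u"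
  shows "\<omega> \<in> close_event M X u s t"
proof -
  have "dist s t \<le> u" "dist (X \<omega> s) (X \<omega> t) \<le> u"
    using assms(2) dist_fst_le[of "graph_map (X \<omega>) s" "graph_map (X \<omega>) t"]
      dist_snd_le[of "graph_map (X \<omega>) s" "graph_map (X \<omega>) t"]
    by (auto simp: graph_map_def)
  moreover have "\<bar>X \<omega> t $ i - X \<omega> s $ i\<bar> \<le> dist (X \<omega> s) (X \<omega> t)" for i
    using dist_vec_nth_le[of "X \<omega> s" i "X \<omega> t"] by (simp add: dist_real_def abs_minus_commute)
  ultimately show ?thesis
    using assms(1) by (auto simp: close_event_def dist_real_def abs_minus_commute intro: order_trans)
qed

text \<open>Markov's inequality bounds the number of close pairs, and Cauchy-Schwarz turns few close pairs
  into many separated points.\<close>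
lemma graph_not_box_bounded:
  fixes X :: "'w \<Rightarrow> real \<Rightarrow> real ^ 'd"
  assumes fbm: "fbm M \<alpha> X" "0 < \<alpha>" and pos: "0 < \<gamma>" "0 < \<kappa>" "\<kappa> * \<sigma> < \<gamma>"
    and B: "\<not> box_bounded \<gamma> B"
    and C: "\<And>r P x. 0 < r \<Longrightarrow> r \<le> 1 \<Longrightarrow> finite P \<Longrightarrow> separated r P \<Longrightarrow>
      real (card P) \<le> 2 * r powr (- \<gamma>) \<Longrightarrow> x \<in> P \<Longrightarrow>
      (\<Sum>t\<in>P. measure M (close_event M X (2 * r powr \<kappa>) x t)) \<le> C"
  shows "AE \<omega> in M. \<not> box_bounded \<sigma> (graph_map (X \<omega>) ` B)"
proof -
  have ps: "prob_space M" using fbm(1) by (simp add: fbm_def)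
  interpret prob_space M by fact
  note [measurable] = close_event_sets[OF fbm]
  \<comment> \<open>Positivity of the constant makes the threshold in \<open>bad\<close> positive,
    as Markov's inequality requires.\<close>
  define C1 where "C1 = max C 1"
  have C1: "0 < C1" "C \<le> C1" by (auto simp: C1_def)
  \<comment> \<open>Half of the available slack: one \<open>\<eta>\<close> is spent in Markov's
    inequality, the other absorbs the constants for small \<open>r\<close>.\<close>
  define \<eta> where "\<eta> = (\<gamma> - \<kappa> * \<sigma>) / 2"
  have \<eta>: "0 < \<eta>" "\<gamma> = 2 * \<eta> + \<kappa> * \<sigma>" using pos by (auto simp: \<eta>_def field_simps)
  have "\<exists>r P. 0 < r \<and> r \<le> 1 / real (Suc n) \<and> finite P \<and> P \<subseteq> B \<and> separated r P \<and>
      r powr (- \<gamma>) \<le> real (card P) \<and> real (card P) \<le> 2 * r powr (- \<gamma>)" for n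
    by (rule not_box_bounded_scales[OF B, of "1 / real (Suc n)"]) (use pos in auto)
  then obtain r P where rP: "\<And>n. 0 < r n" "\<And>n. r n \<le> 1 / real (Suc n)" "\<And>n. finite (P n)"
      "\<And>n. P n \<subseteq> B" "\<And>n. separated (r n) (P n)" "\<And>n. r n powr (- \<gamma>) \<le> real (card (P n))"
      "\<And>n. real (card (P n)) \<le> 2 * r n powr (- \<gamma>)"
    by metis
  have r1: "r n \<le> 1" for n using rP(2)[of n] by (rule order_trans) (simp add: field_simps)
  have r0: "r \<longlonglongrightarrow> 0"
    by (rule tendsto_sandwich[OF _ _ tendsto_const LIMSEQ_inverse_real_of_nat])
      (use rP(1,2) in \<open>auto simp: less_imp_le inverse_eq_divide\<close>)
  define E where "E n s t = close_event M X (2 * r n powr \<kappa>) s t" for n s t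
  \<comment> \<open>\<open>Z n\<close> counts ordered close pairs, including the diagonal; its mean
    is at most \<open>C1\<close> times the number of times.\<close>
  define Z where "Z n \<omega> = (\<Sum>s\<in>P n. \<Sum>t\<in>P n. indicator (E n s t) \<omega> :: real)" for n \<omega>
  define bad where "bad n = {\<omega> \<in> space M. real (card (P n)) * C1 * r n powr (- \<eta>) \<le> Z n \<omega>}" for n
  have cardP: "0 < real (card (P n))" for n
    using rP(6)[of n] rP(1)[of n] by (smt (verit) powr_gt_zero)
  have Em [measurable]: "E n s t \<in> sets M" for n s t by (simp add: E_def)
  have bad_le: "prob (bad n) \<le> r n powr \<eta>" for n
  proof -
    have int: "integrable M (Z n)" unfolding Z_def
      by (intro Bochner_Integration.integrable_sum integrable_real_indicator Em) (simp add: emeasure_eq_measure)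
    have "expectation (Z n) = (\<Sum>s\<in>P n. \<Sum>t\<in>P n. prob (E n s t))"
      unfolding Z_def
      by (simp add: Bochner_Integration.integral_sum Bochner_Integration.integrable_sum
          integrable_real_indicator emeasure_eq_measure)
    also have "\<dots> \<le> (\<Sum>s\<in>P n. C1)"
      unfolding E_def using rP r1 C1 by (intro sum_mono order_trans[OF C C1(2)]) auto
    also have "\<dots> = real (card (P n)) * C1" by simp
    finally have ex: "expectation (Z n) \<le> real (card (P n)) * C1" .
    have pos': "0 < real (card (P n)) * C1 * r n powr (- \<eta>)"
      using cardP[of n] C1 rP(1)[of n] by simp
    have "prob (bad n) \<le> expectation (Z n) / (real (card (P n)) * C1 * r n powr (- \<eta>))"
      unfolding bad_def using pos'
      by (intro integral_Markov_inequality_measure[OF int, of "{}"]) (auto simp: Z_def intro!: sum_nonneg)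
    also have "\<dots> \<le> real (card (P n)) * C1 / (real (card (P n)) * C1 * r n powr (- \<eta>))"
      using pos' by (intro divide_right_mono ex) auto
    also have "\<dots> = r n powr \<eta>"
      using cardP[of n] C1 by (simp add: powr_minus field_simps)
    finally show ?thesis .
  qed
  have r\<eta>: "(\<lambda>n. r n powr \<eta>) \<longlonglongrightarrow> 0"
    using tendsto_powr'[OF r0 tendsto_const, of \<eta>] \<eta>(1) rP(1) by (simp add: less_imp_le)
  have "(\<lambda>n. prob (bad n)) \<longlonglongrightarrow> 0"
    by (rule tendsto_sandwich[OF _ _ tendsto_const r\<eta>]) (simp_all add: bad_le)
  moreover have "bad n \<in> sets M" for n
    unfolding bad_def Z_def by measurable
  ultimately have "AE \<omega> in M. \<forall>k. \<exists>n\<ge>k. \<omega> \<notin> bad n"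
    by (intro AE_infinitely_often_not ps)
  then show ?thesis
  proof (rule AE_mp[OF _ AE_I2], intro impI notI)
    fix \<omega> assume \<omega>: "\<omega> \<in> space M" "\<forall>k. \<exists>n\<ge>k. \<omega> \<notin> bad n"
    let ?g = "graph_map (X \<omega>)"
    assume "box_bounded \<sigma> (?g ` B)"
    then obtain C' \<delta> where "0 < \<delta>" and C': "\<forall>e P. 0 < e \<and> e \<le> \<delta> \<and> finite P \<and> P \<subseteq> ?g ` B \<and>
        separated e P \<longrightarrow> real (card P) \<le> C' * e powr (- \<sigma>)"
      unfolding box_bounded_def by (elim exE conjE)
    have "(\<lambda>n. r n powr \<kappa>) \<longlonglongrightarrow> 0"
      using tendsto_powr'[OF r0 tendsto_const, of \<kappa>] pos(2) rP(1) by (simp add: less_imp_le)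
    then have ev1: "eventually (\<lambda>n. r n powr \<kappa> < \<delta>) sequentially"
      using \<open>0 < \<delta>\<close> by (rule order_tendstoD)
    have "(\<lambda>n. C' * C1 * r n powr \<eta>) \<longlonglongrightarrow> C' * C1 * 0"
      by (intro tendsto_mult tendsto_const r\<eta>)
    then have ev2: "eventually (\<lambda>n. C' * C1 * r n powr \<eta> < 1) sequentially"
      by (intro order_tendstoD) auto
    obtain k where k: "\<And>n. n \<ge> k \<Longrightarrow> r n powr \<kappa> < \<delta> \<and> C' * C1 * r n powr \<eta> < 1"
      using eventually_conj[OF ev1 ev2] by (auto simp: eventually_sequentially)
    obtain n where n: "n \<ge> k" "\<omega> \<notin> bad n" using \<omega>(2) by blast
    let ?e = "r n powr \<kappa>" and ?N = "real (card (P n))"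
    have "0 < ?e" using rP(1)[of n] by simp
    obtain Q where Q: "Q \<subseteq> P n" "inj_on ?g Q" "separated ?e (?g ` Q)"
      "(card (P n))\<^sup>2 \<le> card Q * card {(s, t) \<in> P n \<times> P n. dist (?g s) (?g t) \<le> 2 * ?e}"
      by (rule exists_large_separated_subset[OF rP(3) \<open>0 < ?e\<close>])
    let ?W = "{(s, t) \<in> P n \<times> P n. dist (?g s) (?g t) \<le> 2 * ?e}"
    have "real (card ?W) \<le> Z n \<omega>"
    proof -
      have "real (card ?W) = (\<Sum>p\<in>?W. 1)" by simp
      also have "\<dots> \<le> (\<Sum>(s, t)\<in>?W. indicator (E n s t) \<omega>)"
        using dist_graph_map_imp_close_event[OF \<omega>(1), of X]
        by (intro sum_mono) (auto simp: E_def indicator_def)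
      also have "\<dots> \<le> (\<Sum>(s, t)\<in>P n \<times> P n. indicator (E n s t) \<omega>)"
        using rP(3) by (intro sum_mono2) auto
      also have "\<dots> = Z n \<omega>" unfolding Z_def by (rule sum.cartesian_product[symmetric])
      finally show ?thesis .
    qed
    also have "\<dots> < ?N * C1 * r n powr (- \<eta>)"
      using n(2) \<omega>(1) by (auto simp: bad_def)
    finally have W: "real (card ?W) \<le> ?N * C1 * r n powr (- \<eta>)" by simp
    \<comment> \<open>Few close pairs force \<open>card Q\<close> to be at least
      \<open>?N * r n powr \<eta> / C1\<close>, while \<open>box_bounded\<close> allows at most
      \<open>C' * r n powr (- \<kappa> * \<sigma>)\<close>. Since
      \<open>\<gamma> = 2 * \<eta> + \<kappa> * \<sigma>\<close>, this contradicts the choice of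
      \<open>k\<close>.\<close>
    have "?N * ?N \<le> real (card Q) * real (card ?W)"
      using of_nat_mono[OF Q(4), where 'a = real] by (simp only: of_nat_mult power2_eq_square)
    also have "\<dots> \<le> real (card Q) * (?N * C1 * r n powr (- \<eta>))"
      using W by (intro mult_left_mono) auto
    finally have "?N * ?N \<le> ?N * (real (card Q) * C1 * r n powr (- \<eta>))" by (simp add: mult_ac)
    then have "?N \<le> real (card Q) * C1 * r n powr (- \<eta>)"
      using cardP[of n] by simp
    also have "real (card Q) \<le> C' * ?e powr (- \<sigma>)"
      using C'[rule_format, of ?e "?g ` Q"] k[OF n(1)] \<open>0 < ?e\<close> Q rP(3,4)[of n]
      by (auto simp: card_image intro: finite_subset)
    then have "real (card Q) * C1 * r n powr (- \<eta>) \<le> C' * ?e powr (- \<sigma>) * C1 * r n powr (- \<eta>)"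
      using C1 by (intro mult_right_mono) auto
    also have "\<dots> = C' * C1 * r n powr (\<eta> + (- \<gamma>))"
      using rP(1)[of n] \<eta>(2) by (simp add: powr_powr mult_ac powr_add[symmetric])
    also have "\<dots> = (C' * C1 * r n powr \<eta>) * r n powr (- \<gamma>)"
      by (simp only: powr_add mult_ac)
    also have "\<dots> < 1 * r n powr (- \<gamma>)"
      using k[OF n(1)] rP(1)[of n] by (intro mult_strict_right_mono) auto
    finally show False using rP(6)[of n] by simp
  qed
qed

section \<open>The two admissible scales\<close>

text \<open>The equation for \<open>\<kappa>\<close> makes all powers of \<open>r\<close> cancel:
  with at most \<open>L * r powr (- \<theta>)\<close> other candidate times, the expected number of
  neighbours stays bounded.\<close>

lemma close_event_scaling:
  fixes \<kappa> \<theta> a L r n :: real and d :: nat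
  assumes "0 < r" "0 \<le> n" "n \<le> L * r powr (- \<theta>)" "a < 1" "\<kappa> * real d = a + \<theta> * (1 - a)" "0 \<le> L" "0 \<le> K"
  shows "(2 * r powr \<kappa>) ^ d * (K * r powr (- a) * n powr (1 - a)) \<le> 2 ^ d * (K * L powr (1 - a))"
proof -
  have "n powr (1 - a) \<le> (L * r powr (- \<theta>)) powr (1 - a)"
    using assms by (intro powr_mono2) auto
  also have "\<dots> = L powr (1 - a) * r powr (- \<theta> * (1 - a))"
    using assms by (simp add: powr_mult powr_powr)
  finally have n: "n powr (1 - a) \<le> L powr (1 - a) * r powr (- \<theta> * (1 - a))" .
  have "(2 * r powr \<kappa>) ^ d * (K * r powr (- a) * n powr (1 - a))
      \<le> (2 * r powr \<kappa>) ^ d * (K * r powr (- a) * (L powr (1 - a) * r powr (- \<theta> * (1 - a))))"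
    using assms n by (intro mult_left_mono) auto
  also have "\<dots> = 2 ^ d * (K * L powr (1 - a)) * (r powr (\<kappa> * real d) * r powr (- a) * r powr (- \<theta> * (1 - a)))"
    using assms(1) by (simp add: power_mult_distrib powr_realpow[symmetric] powr_powr mult_ac)
  also have "r powr (\<kappa> * real d) * r powr (- a) * r powr (- \<theta> * (1 - a)) = 1"
    using assms(1) unfolding powr_add[symmetric] assms(5) by simp
  finally show ?thesis by simp
qed

lemma close_event_sum_bounded_range:
  fixes X :: "'w \<Rightarrow> real \<Rightarrow> real ^ 'd"
  assumes "fbm M \<alpha> X" "0 < \<alpha>" "\<alpha> * real CARD('d) < 1"
    and \<kappa>: "\<kappa> = \<alpha> + \<gamma> * (1 - \<alpha> * real CARD('d)) / real CARD('d)"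
  obtains C where "\<And>r P x. 0 < r \<Longrightarrow> r \<le> 1 \<Longrightarrow> finite P \<Longrightarrow> separated r P \<Longrightarrow>
      real (card P) \<le> 2 * r powr (- \<gamma>) \<Longrightarrow> x \<in> P \<Longrightarrow>
      (\<Sum>t\<in>P. measure M (close_event M X (2 * r powr \<kappa>) x t)) \<le> C"
proof -
  define a where "a = \<alpha> * real CARD('d)"
  define K where "K = 2 powr a / (1 - a)"
  show ?thesis
  proof (rule that[of "1 + 2 ^ CARD('d) * (K * 2 powr (1 - a))"])
    fix r :: real and P :: "real set" and x
    assume r: "0 < r" "r \<le> 1" and P: "finite P" "separated r P" "real (card P) \<le> 2 * r powr (- \<gamma>)" "x \<in> P"
    have "(\<Sum>t\<in>P. measure M (close_event M X (2 * r powr \<kappa>) x t))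
        \<le> 1 + (2 * r powr \<kappa>) ^ CARD('d) * (K * r powr (- a) * real (card (P - {x})) powr (1 - a))"
      unfolding a_def K_def using assms r P by (intro sum_close_event_prob_le) auto
    also have "\<dots> \<le> 1 + 2 ^ CARD('d) * (K * 2 powr (1 - a))"
    proof (intro add_left_mono close_event_scaling[where \<theta> = \<gamma>])
      have "card (P - {x}) \<le> card P" using P(1) by (intro card_mono) auto
      then show "real (card (P - {x})) \<le> 2 * r powr (- \<gamma>)" using P(3) by linarith
      show "\<kappa> * real CARD('d) = a + \<gamma> * (1 - a)"
        unfolding \<kappa> a_def by (simp add: field_simps)
    qed (use r assms in \<open>auto simp: a_def K_def\<close>)
    finally show "(\<Sum>t\<in>P. measure M (close_event M X (2 * r powr \<kappa>) x t))
      \<le> 1 + 2 ^ CARD('d) * (K * 2 powr (1 - a))" .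
  qed
qed

text \<open>Only times within \<open>2 * r powr \<kappa>\<close> of \<open>x\<close> contribute.
  Besides \<open>x\<close>, separation leaves at most \<open>4 * r powr (\<kappa> - 1)\<close> of
  them, so \<open>\<theta> = 1 - \<kappa>\<close> and \<open>L = 4\<close>; the exponent equation
  becomes \<open>\<kappa> * (d + 1 - a) = 1\<close>.\<close>

lemma close_event_sum_bounded_graph:
  fixes X :: "'w \<Rightarrow> real \<Rightarrow> real ^ 'd"
  assumes "fbm M \<alpha> X" "0 < \<alpha>" "\<alpha> * real CARD('d) < 1"
    and \<kappa>: "\<kappa> = 1 / (real CARD('d) + 1 - \<alpha> * real CARD('d))"
  obtains C where "\<And>r P x. 0 < r \<Longrightarrow> r \<le> 1 \<Longrightarrow> finite P \<Longrightarrow> separated r P \<Longrightarrow> x \<in> P \<Longrightarrow>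
      (\<Sum>t\<in>P. measure M (close_event M X (2 * r powr \<kappa>) x t)) \<le> C"
proof -
  define a where "a = \<alpha> * real CARD('d)"
  define K where "K = 2 powr a / (1 - a)"
  show ?thesis
  proof (rule that[of "1 + 2 ^ CARD('d) * (K * 4 powr (1 - a))"])
    fix r :: real and P :: "real set" and x
    assume r: "0 < r" "r \<le> 1" and P: "finite P" "separated r P" "x \<in> P"
    let ?u = "2 * r powr \<kappa>"
    define Q where "Q = {t \<in> P. \<bar>t - x\<bar> \<le> ?u}"
    have Q: "finite Q" "x \<in> Q" "separated r Q"
      using P by (auto simp: Q_def intro: separated_mono)
    have "(\<Sum>t\<in>P. measure M (close_event M X ?u x t)) = (\<Sum>t\<in>Q. measure M (close_event M X ?u x t))"
      using P(1) by (intro sum.mono_neutral_right) (auto simp: Q_def close_event_def)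
    also have "\<dots> \<le> 1 + ?u ^ CARD('d) * (K * r powr (- a) * real (card (Q - {x})) powr (1 - a))"
      unfolding a_def K_def using assms r Q by (intro sum_close_event_prob_le) auto
    also have "\<dots> \<le> 1 + 2 ^ CARD('d) * (K * 4 powr (1 - a))"
    proof (intro add_left_mono close_event_scaling[where \<theta> = "1 - \<kappa>"])
      have "real (card (Q - {x})) * r \<le> 2 * ?u"
        using Q by (intro separated_real_card_le_interval) (auto simp: Q_def)
      then show "real (card (Q - {x})) \<le> 4 * r powr (- (1 - \<kappa>))"
        using r by (simp add: powr_diff field_simps)
      have "real CARD('d) + 1 - a \<noteq> 0" using assms(3) by (simp add: a_def)
      then have "\<kappa> * (real CARD('d) + 1 - a) = 1" unfolding \<kappa> a_def by simp
      then show "\<kappa> * real CARD('d) = a + (1 - \<kappa>) * (1 - a)"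
        by (simp add: algebra_simps)
    qed (use r assms in \<open>auto simp: a_def K_def\<close>)
    finally show "(\<Sum>t\<in>P. measure M (close_event M X ?u x t))
      \<le> 1 + 2 ^ CARD('d) * (K * 4 powr (1 - a))" .
  qed
qed

section \<open>Lower bounds for the packing dimension of the graph\<close>

lemma packing_measure_neq_0_below_dim:
  "packing_dim E = ereal \<beta> \<Longrightarrow> 0 \<le> s \<Longrightarrow> s < \<beta> \<Longrightarrow> packing_measure s E \<noteq> 0"
  unfolding packing_dim_def by (metis (mono_tags, lifting) Inf_lower ereal_less_eq(3) image_eqI mem_Collect_eq not_le)

lemma graph_packing_dim_ge:
  fixes X :: "'w \<Rightarrow> real \<Rightarrow> real ^ 'd"
  assumes fbm: "fbm M \<alpha> X" "0 < \<alpha>" and A: "analytic_set A" "packing_dim A = ereal \<beta>"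
    and pos: "0 < \<gamma>" "\<gamma> < \<beta>" "0 < \<kappa>" "\<kappa> * \<sigma> < \<gamma>"
    and C: "\<And>r P x. 0 < r \<Longrightarrow> r \<le> 1 \<Longrightarrow> finite P \<Longrightarrow> separated r P \<Longrightarrow>
      real (card P) \<le> 2 * r powr (- \<gamma>) \<Longrightarrow> x \<in> P \<Longrightarrow>
      (\<Sum>t\<in>P. measure M (close_event M X (2 * r powr \<kappa>) x t)) \<le> C"
  shows "AE \<omega> in M. ereal \<sigma> \<le> packing_dim (graph_map (X \<omega>) ` A)"
proof -
  \<comment> \<open>The kernel is taken at an exponent strictly above \<open>\<gamma>\<close>,
    because \<open>box_bounded \<gamma>\<close> forces null packing measure only at larger
    exponents.\<close>
  obtain \<gamma>' where \<gamma>': "\<gamma> < \<gamma>'" "\<gamma>' < \<beta>" using dense[OF pos(2)] by blast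
  have "packing_measure \<gamma>' A \<noteq> 0"
    using packing_measure_neq_0_below_dim[OF A(2)] \<gamma>' pos by simp
  from analytic_set_countable_kernel[OF A(1) this, where 'b = "real \<times> (real ^ 'd)"]
  obtain \<B> where \<B>: "countable \<B>" "\<And>B. B \<in> \<B> \<Longrightarrow> packing_measure \<gamma>' B \<noteq> 0"
    "\<And>(g :: real \<Rightarrow> real \<times> (real ^ 'd)) s. continuous_on UNIV g \<Longrightarrow> packing_measure s (g ` A) = 0 \<Longrightarrow>
      \<exists>B\<in>\<B>. box_bounded s (g ` B)"
    by metis
  have "AE \<omega> in M. \<not> box_bounded \<sigma> (graph_map (X \<omega>) ` B)" if "B \<in> \<B>" for B
  proof (rule graph_not_box_bounded[OF fbm pos(1,3,4) _ C])
    show "\<not> box_bounded \<gamma> B"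
      using packing_measure_eq_0_if_box_bounded[of \<gamma> B \<gamma>'] \<B>(2)[OF that] \<gamma>' pos by auto
  qed
  \<comment> \<open>The family is fixed before the path is drawn, so only countably many null events
    are combined.\<close>
  then have "AE \<omega> in M. \<forall>B\<in>\<B>. \<not> box_bounded \<sigma> (graph_map (X \<omega>) ` B)"
    using \<B>(1) by (simp add: AE_ball_countable)
  moreover have "AE \<omega> in M. continuous_on UNIV (X \<omega>)"
    using fbm(1) by (simp add: fbm_def)
  ultimately show ?thesis
  proof eventually_elim
    case (elim \<omega>)
    have cont: "continuous_on UNIV (graph_map (X \<omega>))"
      unfolding graph_map_def by (intro continuous_intros elim)
    have "\<sigma> \<le> s" if "packing_measure s (graph_map (X \<omega>) ` A) = 0" for s
      using \<B>(3)[OF cont that] elim(1) box_bounded_mono_exponent by (meson less_imp_le not_le)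
    then show ?case
      unfolding packing_dim_def by (intro Inf_greatest) auto
  qed
qed

text \<open>As \<open>\<gamma>\<close> increases to \<open>\<beta>\<close>, the exponent
  \<open>\<gamma> / \<kappa> \<gamma>\<close> tends to the asserted bound, so some
  \<open>\<gamma> < \<beta>\<close> already satisfies
  \<open>\<kappa> \<gamma> * \<sigma> < \<gamma>\<close>.\<close>

lemma graph_packing_dim_ge_range_bound:
  fixes X :: "'w \<Rightarrow> real \<Rightarrow> real ^ 'd"
  assumes "fbm M \<alpha> X" "0 < \<alpha>" "\<alpha> * real CARD('d) < 1" "analytic_set A" "packing_dim A = ereal \<beta>" "0 < \<beta>"
    and \<sigma>: "\<sigma> < \<beta> * real CARD('d) / (\<alpha> * real CARD('d) + \<beta> * (1 - \<alpha> * real CARD('d)))"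
  shows "AE \<omega> in M. ereal \<sigma> \<le> packing_dim (graph_map (X \<omega>) ` A)"
proof -
  define d where "d = real CARD('d)"
  have "0 < d" by (simp add: d_def)
  have ad: "0 < \<alpha> * d" "\<alpha> * d < 1" using assms by (auto simp: d_def)
  define \<kappa> where "\<kappa> \<gamma> = \<alpha> + \<gamma> * (1 - \<alpha> * d) / d" for \<gamma>
  have "0 < \<alpha> * d + \<beta> * (1 - \<alpha> * d)" using ad assms(6) by (simp add: add_pos_pos)
  then have "\<sigma> * (\<alpha> * d + \<beta> * (1 - \<alpha> * d)) < \<beta> * d"
    using \<sigma> unfolding d_def[symmetric] by (simp add: pos_less_divide_eq)
  then have "\<kappa> \<beta> * \<sigma> < \<beta>"
    using \<open>0 < d\<close> by (simp add: \<kappa>_def field_simps)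
  moreover have "((\<lambda>\<gamma>. \<gamma> - \<kappa> \<gamma> * \<sigma>) \<longlongrightarrow> \<beta> - \<kappa> \<beta> * \<sigma>) (at_left \<beta>)"
    unfolding \<kappa>_def using \<open>0 < d\<close> by (intro tendsto_intros) auto
  ultimately have "eventually (\<lambda>\<gamma>. 0 < \<gamma> - \<kappa> \<gamma> * \<sigma>) (at_left \<beta>)"
    by (intro order_tendstoD) auto
  moreover have "eventually (\<lambda>\<gamma>. \<gamma> \<in> {0<..<\<beta>}) (at_left \<beta>)"
    using assms(6) by (rule eventually_at_left_real)
  ultimately have "eventually (\<lambda>\<gamma>. 0 < \<gamma> - \<kappa> \<gamma> * \<sigma> \<and> \<gamma> \<in> {0<..<\<beta>}) (at_left \<beta>)"
    by (rule eventually_conj)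
  then obtain \<gamma> where \<gamma>: "0 < \<gamma> - \<kappa> \<gamma> * \<sigma>" "\<gamma> \<in> {0<..<\<beta>}"
    using eventually_happens'[OF trivial_limit_at_left_real] by fastforce
  have "0 < \<kappa> \<gamma>" using \<gamma> ad assms(2) \<open>0 < d\<close> by (auto simp: \<kappa>_def intro!: add_pos_pos)
  obtain C where "\<And>r P x. 0 < r \<Longrightarrow> r \<le> 1 \<Longrightarrow> finite P \<Longrightarrow> separated r P \<Longrightarrow>
      real (card P) \<le> 2 * r powr (- \<gamma>) \<Longrightarrow> x \<in> P \<Longrightarrow>
      (\<Sum>t\<in>P. measure M (close_event M X (2 * r powr \<kappa> \<gamma>) x t)) \<le> C"
    using close_event_sum_bounded_range[OF assms(1-3), of "\<kappa> \<gamma>" \<gamma>] unfolding \<kappa>_def d_def by metis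
  then show ?thesis
    by (rule graph_packing_dim_ge[OF assms(1,2,4,5), of \<gamma> "\<kappa> \<gamma>", rotated 4])
      (use \<gamma> \<open>0 < \<kappa> \<gamma>\<close> in auto)
qed

lemma graph_packing_dim_ge_graph_bound:
  fixes X :: "'w \<Rightarrow> real \<Rightarrow> real ^ 'd"
  assumes "fbm M \<alpha> X" "0 < \<alpha>" "\<alpha> * real CARD('d) < 1" "analytic_set A" "packing_dim A = ereal \<beta>" "0 < \<beta>"
    and \<sigma>: "\<sigma> < \<beta> * (real CARD('d) + 1 - \<alpha> * real CARD('d))"
  shows "AE \<omega> in M. ereal \<sigma> \<le> packing_dim (graph_map (X \<omega>) ` A)"
proof -
  define \<kappa> where "\<kappa> = 1 / (real CARD('d) + 1 - \<alpha> * real CARD('d))"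
  have D: "0 < real CARD('d) + 1 - \<alpha> * real CARD('d)" using assms(3) by simp
  then have "0 < \<kappa>" by (simp add: \<kappa>_def)
  have "\<kappa> * \<sigma> < \<beta>" using \<sigma> D by (simp add: \<kappa>_def field_simps)
  \<comment> \<open>Here \<open>\<kappa>\<close> does not depend on \<open>\<gamma>\<close>; the
    maximum with 0 keeps \<open>\<gamma>\<close> positive when \<open>\<sigma>\<close> is
    negative.\<close>
  then obtain \<gamma> where \<gamma>: "max 0 (\<kappa> * \<sigma>) < \<gamma>" "\<gamma> < \<beta>"
    using dense[of "max 0 (\<kappa> * \<sigma>)" \<beta>] assms(6) by auto
  obtain C where "\<And>r P x. 0 < r \<Longrightarrow> r \<le> 1 \<Longrightarrow> finite P \<Longrightarrow> separated r P \<Longrightarrow> x \<in> P \<Longrightarrow>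
      (\<Sum>t\<in>P. measure M (close_event M X (2 * r powr \<kappa>) x t)) \<le> C"
    using close_event_sum_bounded_graph[OF assms(1-3) \<kappa>_def] by metis
  then show ?thesis
    by (intro graph_packing_dim_ge[OF assms(1,2,4,5), of \<gamma> \<kappa> \<sigma> C])
      (use \<gamma> \<open>0 < \<kappa>\<close> in auto)
qed

theorem theorem1p15:
  fixes M :: "'w measure" and X :: "'w \<Rightarrow> real \<Rightarrow> real ^ 'd"
    and \<alpha> \<beta> :: real and A :: "real set"
  assumes "0 < \<alpha>" "\<alpha> < 1" "1 > \<alpha> * real CARD('d)"
    and "fbm M \<alpha> X"
    and "analytic_set A" and "packing_dim A = ereal \<beta>"
  shows "AE \<omega> in M.
           ereal (max (\<beta> * real CARD('d) / (\<alpha> * real CARD('d) + \<beta> * (1 - \<alpha> * real CARD('d))))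
                      (\<beta> * (real CARD('d) + 1 - \<alpha> * real CARD('d))))
           \<le> packing_dim (graph_map (X \<omega>) ` A)"
proof (cases "\<beta> = 0")
  case True
  \<comment> \<open>For \<open>\<beta> = 0\<close> both terms of the maximum vanish.\<close>
  then show ?thesis by (simp add: packing_dim_nonneg flip: zero_ereal_def)
next
  case False
  then have "0 < \<beta>" using packing_dim_nonneg[of A] assms(6) by simp
  define D where "D = max (\<beta> * real CARD('d) / (\<alpha> * real CARD('d) + \<beta> * (1 - \<alpha> * real CARD('d))))
                      (\<beta> * (real CARD('d) + 1 - \<alpha> * real CARD('d)))"
  have "AE \<omega> in M. ereal \<sigma> \<le> packing_dim (graph_map (X \<omega>) ` A)" if "\<sigma> < D" for \<sigma>
    using that unfolding D_def less_max_iff_disj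
    using graph_packing_dim_ge_range_bound[OF assms(4,1,3,5,6) \<open>0 < \<beta>\<close>]
      graph_packing_dim_ge_graph_bound[OF assms(4,1,3,5,6) \<open>0 < \<beta>\<close>] by blast
  \<comment> \<open>A sequence of exponents increasing to \<open>D\<close> keeps the exceptional set
    a countable union of null sets.\<close>
  then have "AE \<omega> in M. \<forall>n. ereal (D - 1 / real (Suc n)) \<le> packing_dim (graph_map (X \<omega>) ` A)"
    unfolding AE_all_countable by simp
  then have "AE \<omega> in M. ereal D \<le> packing_dim (graph_map (X \<omega>) ` A)"
  proof eventually_elim
    case (elim \<omega>)
    have "(\<lambda>n. D - inverse (real (Suc n))) \<longlonglongrightarrow> D - 0"
      by (intro tendsto_diff tendsto_const LIMSEQ_inverse_real_of_nat)
    then have "(\<lambda>n. ereal (D - 1 / real (Suc n))) \<longlonglongrightarrow> ereal D"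
      by (simp add: inverse_eq_divide)
    then show ?case
      by (rule LIMSEQ_le_const2) (use elim in auto)
  qed
  then show ?thesis unfolding D_def .
qed

end
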